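(* Let $K\ge2$ be an integer, $\beta>0$, $\boldsymbol{\alpha}=(\alpha_1,\ldots,\alpha_K)$ with $\alpha_i>0$, and $\theta=|\boldsymbol{\alpha}|=\sum_i\alpha_i$. Let $Z_{i,t}$, $i=1,\ldots,K$, be independent Cox--Ingersoll--Ross processes on $[0,\infty)$, $Z_{i,t}$ having generator $$\mathcal{B}_if(z_i)=\tfrac12(\alpha_i-\beta z_i)f'(z_i)+\tfrac12z_if''(z_i).$$ For $a>0$ define $h_a^C:\mathbb{R}_+\times\mathbb{Z}_+\times\mathbb{R}_+\to\mathbb{R}$ by $$h_a^C(z,m,s)=\frac{\Gamma(a)}{\Gamma(a+m)}\Big(\frac{\beta+s}{\beta}\Big)^a(\beta+s)^mz^me^{-sz},$$ define $h^W:\mathbb{R}_+^K\times\mathbb{Z}_+^K\to\mathbb{R}$ by $$h^W(\mathbf{x},\mathbf{m})=\frac{\Gamma(\theta+|\mathbf{m}|)}{\Gamma(\theta)}\prod_{i=1}^K\frac{\Gamma(\alpha_i)}{\Gamma(\alpha_i+m_i)}\mathbf{x}^{\mathbf{m}},$$ and define $h:\mathbb{R}_+^K\times\mathbb{Z}_+^K\times\mathbb{R}_+\to\mathbb{R}$ by $$h(\mathbf{z},\mathbf{m},s)=h_\theta^C(|\mathbf{z}|,|\mathbf{m}|,s)\,h^W(\mathbf{x},\mathbf{m}),\qquad\mathbf{x}=\mathbf{z}/|\mathbf{z}|.$$ Then the joint process $\mathbf{Z}_t=(Z_{1,t},\ldots,Z_{K,t})$, $t\ge0$, is dual with respect to $h$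 to the Markov process $(\mathbf{M}_t,S_t)_{t\ge0}$ on $\mathbb{Z}_+^K\times\mathbb{R}_+$ with generator $$Bg(\mathbf{m},s)=\frac12|\mathbf{m}|(\beta+s)\sum_{i=1}^K\frac{m_i}{|\mathbf{m}|}\big[g(\mathbf{m}-\mathbf{e}_i,s)-g(\mathbf{m},s)\big]-\frac12s(\beta+s)\frac{\partial g(\mathbf{m},s)}{\partial s},$$ that is, $$\mathbb{E}^{\mathbf{z}}[h(\mathbf{Z}_t,\mathbf{m},s)]=\mathbb{E}^{(\mathbf{m},s)}[h(\mathbf{z},\mathbf{M}_t,S_t)]\qquad\forall\,\mathbf{z}\in\mathbb{R}_+^K,\ \mathbf{m}\in\mathbb{Z}_+^K,\ s\in\mathbb{R}_+,\ t\ge0.$$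
   Context: Notation: $\mathbb{Z}_+=\{0,1,\ldots\}$, $\mathbb{R}_+=[0,\infty)$; $|\mathbf{z}|=\sum_iz_i$; $\mathbf{x}^{\mathbf{m}}=\prod_ix_i^{m_i}$; $\mathbf{e}_i$ is the $i$th canonical unit vector. When $\mathbf{z}=\mathbf{0}$, the factor $|\mathbf{z}|^{|\mathbf{m}|}\mathbf{x}^{\mathbf{m}}$ appearing in $h$ is read as $\mathbf{z}^{\mathbf{m}}$; when $|\mathbf{m}|=0$ the first term of $B$ is read as 0. The CIR generator $\mathcal{B}_i$ acts on $C^2([0,\infty))$ functions vanishing at infinity; the corresponding process is reversible and ergodic with respect to the gamma distribution $\mathrm{Ga}(\alpha_i,\beta)$ (shape $\alpha_i$, rate $\beta$). The process $(\mathbf{M}_t,S_t)$: $S_t$ evolves deterministically by the ODE $dS_t/dt=-\frac12S_t(\beta+S_t)$, and given $S$, $\mathbf{M}_t$ is a death process on $\mathbb{Z}_+^K$ with jumps prescribed by $B$. $\mathbb{E}^{\mathbf{z}}$ and $\mathbb{E}^{(\mathbf{m},s)}$ denote expectations for the processes started from $\mathbf{Z}_0=\mathbf{z}$ and $(\mathbf{M}_0,S_0)=(\mathbf{m},s)$ respectively. *)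

theory Defs
  imports "HOL-Probability.Probability"
begin

section \<open>Markov processes and their generators\<close>

definition transition_function :: "'a measure \<Rightarrow> (real \<Rightarrow> 'a \<Rightarrow> 'a measure) \<Rightarrow> bool" where
  "transition_function E P \<longleftrightarrow>
     (\<forall>t\<ge>0. P t \<in> E \<rightarrow>\<^sub>M prob_algebra E) \<and>
     (\<forall>x\<in>space E. P 0 x = return E x) \<and>
     (\<forall>s\<ge>0. \<forall>t\<ge>0. \<forall>x\<in>space E. P (s + t) x = P s x \<bind> P t)"

text \<open>
  The infinitesimal generator is the derivative at \<open>t = 0\<close> of the semigroup
  \<open>f \<mapsto> (\<lambda>x. \<integral>y. f y \<partial>P t x)\<close>. The limits are taken in the sense of bounded pointwise convergence
  on the state space (Dynkin's weak generator), because the semigroup of the dual process below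
  does not leave the space of continuous functions vanishing at infinity invariant. Whenever the
  limits hold uniformly (as for a Feller semigroup) they hold in this sense. The operator \<open>A\<close> need
  only be the restriction of the full generator to the set \<open>D\<close> of test functions.
\<close>

definition has_generator ::
  "'a measure \<Rightarrow> (real \<Rightarrow> 'a \<Rightarrow> 'a measure) \<Rightarrow> ('a \<Rightarrow> real) set
    \<Rightarrow> (('a \<Rightarrow> real) \<Rightarrow> ('a \<Rightarrow> real)) \<Rightarrow> bool" where
  "has_generator E P D A \<longleftrightarrow>
     (\<forall>f\<in>D.
        (\<exists>C. \<forall>t>0. \<forall>x\<in>space E. \<bar>((\<integral>y. f y \<partial>P t x) - f x) / t\<bar> \<le> C) \<and>
        (\<forall>x\<in>space E.
           ((\<lambda>t. ((\<integral>y. f y \<partial>P t x) - f x) / t) \<longlongrightarrow> A f x) (at_right 0) \<and>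
           ((\<lambda>t. \<integral>y. A f y \<partial>P t x) \<longlongrightarrow> A f x) (at_right 0)))"

definition natural_filtration ::
  "'w measure \<Rightarrow> 'a measure \<Rightarrow> (real \<Rightarrow> 'w \<Rightarrow> 'a) \<Rightarrow> real \<Rightarrow> 'w measure" where
  "natural_filtration M E X s =
     sigma (space M) {X u -` B \<inter> space M | u B. 0 \<le> u \<and> u \<le> s \<and> B \<in> sets E}"

text \<open>
  \<open>X\<close> is, under \<open>M\<close>, a Markov process with state space \<open>E\<close> and transition function \<open>P\<close>, started
  at \<open>x\<close>. Times are real numbers; only \<open>X t\<close> for \<open>t \<ge> 0\<close> matters.
\<close>

definition markov_process ::
  "'w measure \<Rightarrow> 'a measure \<Rightarrow> (real \<Rightarrow> 'a \<Rightarrow> 'a measure) \<Rightarrow> 'a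
    \<Rightarrow> (real \<Rightarrow> 'w \<Rightarrow> 'a) \<Rightarrow> bool" where
  "markov_process M E P x X \<longleftrightarrow>
     prob_space M \<and>
     (\<forall>t\<ge>0. X t \<in> M \<rightarrow>\<^sub>M E) \<and>
     (AE \<omega> in M. X 0 \<omega> = x) \<and>
     (\<forall>s\<ge>0. \<forall>t\<ge>0. \<forall>B\<in>sets E.
        AE \<omega> in M.
          real_cond_exp M (natural_filtration M E X s) (\<lambda>\<omega>. indicator B (X (s + t) \<omega>)) \<omega>
            = measure (P t (X s \<omega>)) B)"

definition markov_process_with_generator ::
  "'w measure \<Rightarrow> 'a measure \<Rightarrow> ('a \<Rightarrow> real) set \<Rightarrow> (('a \<Rightarrow> real) \<Rightarrow> ('a \<Rightarrow> real)) \<Rightarrow> 'a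
    \<Rightarrow> (real \<Rightarrow> 'w \<Rightarrow> 'a) \<Rightarrow> bool" where
  "markov_process_with_generator M E D A x X \<longleftrightarrow>
     (\<exists>P. transition_function E P \<and> has_generator E P D A \<and> markov_process M E P x X)"


section \<open>Cox--Ingersoll--Ross processes\<close>

abbreviation half_line :: "real measure" where
  "half_line \<equiv> restrict_space borel {0..}"

text \<open>The derivative on \<open>[0, \<infinity>)\<close>, one-sided at the boundary point \<open>0\<close>.\<close>

definition hderiv :: "(real \<Rightarrow> real) \<Rightarrow> real \<Rightarrow> real" where
  "hderiv f z = vector_derivative f (at z within {0..})"

definition C1_half_line :: "(real \<Rightarrow> real) set" where
  "C1_half_line = {f. f differentiable_on {0..} \<and> continuous_on {0..} (hderiv f)}"

definition C2_half_line :: "(real \<Rightarrow> real) set" where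
  "C2_half_line = {f. f differentiable_on {0..} \<and> hderiv f \<in> C1_half_line}"

definition cir_gen :: "real \<Rightarrow> real \<Rightarrow> (real \<Rightarrow> real) \<Rightarrow> real \<Rightarrow> real" where
  "cir_gen a \<beta> f z = 1/2 * (a - \<beta> * z) * hderiv f z + 1/2 * z * hderiv (hderiv f) z"

definition cir_domain :: "real \<Rightarrow> real \<Rightarrow> (real \<Rightarrow> real) set" where
  "cir_domain a \<beta> =
     {f \<in> C2_half_line. (f \<longlongrightarrow> 0) at_top \<and> (cir_gen a \<beta> f \<longlongrightarrow> 0) at_top}"

definition cir_process ::
  "'w measure \<Rightarrow> real \<Rightarrow> real \<Rightarrow> real \<Rightarrow> (real \<Rightarrow> 'w \<Rightarrow> real) \<Rightarrow> bool" where
  "cir_process M a \<beta> z X \<longleftrightarrow>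
     markov_process_with_generator M half_line (cir_domain a \<beta>) (cir_gen a \<beta>) z X"

text \<open>Independence of whole paths, i.e. of the processes as random elements of the product
  space \<open>[0, \<infinity>)\<close> to the power \<open>[0, \<infinity>)\<close>.\<close>

definition independent_processes ::
  "'w measure \<Rightarrow> 'a measure \<Rightarrow> ('i \<Rightarrow> real \<Rightarrow> 'w \<Rightarrow> 'a) \<Rightarrow> bool" where
  "independent_processes M E X \<longleftrightarrow>
     prob_space.indep_vars M (\<lambda>i. \<Pi>\<^sub>M t\<in>{0..}. E) (\<lambda>i \<omega>. \<lambda>t\<in>{0..}. X i t \<omega>) UNIV"


section \<open>The dual process\<close>

definition total :: "'a::comm_monoid_add ^ 'n \<Rightarrow> 'a" where
  "total v = (\<Sum>i\<in>UNIV. v $ i)"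

definition dual_space :: "((nat ^ 'n) \<times> real) measure" where
  "dual_space = count_space UNIV \<Otimes>\<^sub>M half_line"

text \<open>For \<open>m $ i = 0\<close> the vector \<open>m - axis i 1\<close> is a junk value, but it gets the weight \<open>0\<close>; for
  \<open>total m = 0\<close> the first term is \<open>0\<close>.\<close>

definition dual_gen ::
  "real \<Rightarrow> ((nat ^ 'n) \<times> real \<Rightarrow> real) \<Rightarrow> (nat ^ 'n) \<times> real \<Rightarrow> real" where
  "dual_gen \<beta> g = (\<lambda>(m, s).
     1/2 * real (total m) * (\<beta> + s) *
       (\<Sum>i\<in>UNIV. real (m $ i) / real (total m) * (g (m - axis i 1, s) - g (m, s)))
     - 1/2 * s * (\<beta> + s) * hderiv (\<lambda>r. g (m, r)) s)"

text \<open>Test functions for the dual process: bounded, continuously differentiable in \<open>s\<close>, and with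
  bounded image under the generator, whose coefficients are unbounded.\<close>

definition dual_domain :: "real \<Rightarrow> ((nat ^ 'n) \<times> real \<Rightarrow> real) set" where
  "dual_domain \<beta> =
     {g. (\<forall>m. (\<lambda>r. g (m, r)) \<in> C1_half_line) \<and>
         bounded (g ` (UNIV \<times> {0..})) \<and> bounded (dual_gen \<beta> g ` (UNIV \<times> {0..}))}"

definition dual_process ::
  "'w measure \<Rightarrow> real \<Rightarrow> nat ^ 'n \<Rightarrow> real
    \<Rightarrow> (real \<Rightarrow> 'w \<Rightarrow> nat ^ 'n) \<Rightarrow> (real \<Rightarrow> 'w \<Rightarrow> real) \<Rightarrow> bool" where
  "dual_process N \<beta> m s M S \<longleftrightarrow>
     markov_process_with_generator N dual_space (dual_domain \<beta>) (dual_gen \<beta>) (m, s)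
       (\<lambda>t \<omega>. (M t \<omega>, S t \<omega>))"


section \<open>The duality function\<close>

definition mpow :: "real ^ 'n \<Rightarrow> nat ^ 'n \<Rightarrow> real" where
  "mpow x m = (\<Prod>i\<in>UNIV. (x $ i) ^ (m $ i))"

definition hC :: "real \<Rightarrow> real \<Rightarrow> real \<Rightarrow> nat \<Rightarrow> real \<Rightarrow> real" where
  "hC \<beta> a z m s =
     Gamma a / Gamma (a + real m) * ((\<beta> + s) / \<beta>) powr a * (\<beta> + s) ^ m * z ^ m * exp (- s * z)"

definition hW :: "real ^ 'n \<Rightarrow> real ^ 'n \<Rightarrow> nat ^ 'n \<Rightarrow> real" where
  "hW \<alpha> x m =
     Gamma (total \<alpha> + real (total m)) / Gamma (total \<alpha>) *
       (\<Prod>i\<in>UNIV. Gamma (\<alpha> $ i) / Gamma (\<alpha> $ i + real (m $ i))) * mpow x m"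

definition h :: "real \<Rightarrow> real ^ 'n \<Rightarrow> real ^ 'n \<Rightarrow> nat ^ 'n \<Rightarrow> real \<Rightarrow> real" where
  "h \<beta> \<alpha> z m s = hC \<beta> (total \<alpha>) (total z) (total m) s * hW \<alpha> ((1 / total z) *\<^sub>R z) m"

text \<open>
  At \<open>z = 0\<close> the product of \<open>total z ^ total m\<close> with the monomial in \<open>z / total z\<close> has to be read
  as \<open>mpow z m\<close>. Division by zero being zero and \<open>0 ^ 0\<close> being one, the formula already does this:
\<close>

lemma h_zero_convention:
  fixes z :: "real ^ 'n"
  assumes "\<And>i. 0 \<le> z $ i"
  shows "total z ^ total m * mpow ((1 / total z) *\<^sub>R z) m = mpow z m"
proof (cases "total z = 0")
  case False
  have "total z ^ total m = (\<Prod>i\<in>UNIV. total z ^ (m $ i))"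
    unfolding total_def[of m] by (simp add: power_sum)
  then show ?thesis
    using False by (simp add: mpow_def power_divide prod_dividef)
next
  case True
  then have "z $ i = 0" for i
    using assms by (simp add: total_def sum_nonneg_eq_0_iff)
  then show ?thesis
    by (cases "total m = 0") (auto simp: True mpow_def total_def prod_zero_iff power_0_left)
qed

end

theory Submission
  imports Defs
begin

text \<open>
  Both sides satisfy linear differential equations which can be matched. For the dual process the
  coordinate \<open>S / (\<beta> + S)\<close> and its powers are eigenfunctions of the generator, so its first two moments
  show that \<open>S\<close> follows the deterministic flow; the test functions \<open>indicator {k} M * \<beta> / (\<beta> + S)\<close>
  then give Kolmogorov's forward equation for the probabilities \<open>law t k\<close> of \<open>M\<^sub>t = k\<close>. The duality
  function is a product of one-dimensional factors \<open>hC\<close>, each of the form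
  \<open>const * z ^ j * exp (- \<mu> z)\<close>, and along the characteristic \<open>\<mu> = S\<close> their expectations under the
  Cox--Ingersoll--Ross processes satisfy the backward equation of the same death process. Hence
  \<open>\<Sum>k. law (t - r) k * E (h (Z\<^sub>r, k, S\<^bsub>t-r\<^esub>))\<close> does not depend on \<open>r\<close>, which is the claim.
  For \<open>s = 0\<close> the factors \<open>z ^ j\<close> are no admissible test functions; therefore the flow on the
  Cox--Ingersoll--Ross side is started at \<open>s + e\<close>, and \<open>e\<close> tends to \<open>0\<close> at the end.
\<close>

section \<open>One-sided derivatives\<close>

text \<open>Each process is given only through some transition function whose weak generator is
  known on a set of test functions. No density, path construction or uniqueness statement enters, so
  every fact has to come from a suitable test function, and generators supply right derivatives
  only. The equation of \<open>S\<close> is forced by the Cox--Ingersoll--Ross generator: applied to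
  \<open>z ^ j * exp (- \<mu> * z)\<close> it yields a term in \<open>z ^ (j + 1)\<close> with
  coefficient \<open>\<mu> * (\<beta> + \<mu>) / 2\<close>. A fixed rate leaves this term over; a
  rate moving with exactly that speed removes it, and the normalised remainder couples
  \<open>j\<close> to \<open>j - 1\<close> as in a death process. The shift by \<open>e\<close> is
  made on one side only, since the law of the dual process is tied to its starting point
  \<open>(m, s)\<close>. The interpolating sum is therefore constant only up to an error of order
  \<open>e\<close>. Monotone rather than dominated convergence carries the expectation from
  \<open>s + e\<close> to \<open>s\<close>, because integrability at \<open>s = 0\<close> is itself
  part of the claim.\<close>

lemma right_derivative_nonpos_imp_le:
  fixes f :: "real \<Rightarrow> real"
  assumes ab: "a \<le> b" and cont: "continuous_on {a..b} f"
    and deriv: "\<And>x. a \<le> x \<Longrightarrow> x < b \<Longrightarrow>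
      ((\<lambda>h. (f (x + h) - f x) / h) \<longlongrightarrow> f' x) (at_right 0) \<and> f' x \<le> 0"
  shows "f b \<le> f a"
proof -
  have *: "f b \<le> f a + e * (b - a)" if e: "e > 0" for e
  proof (rule ccontr)
    \<comment> \<open>The tilt by \<open>e\<close> turns a nonpositive right derivative into strict
      decrease of \<open>g\<close>. At the last point \<open>c\<close> with
      \<open>g c \<le> 0\<close> this contradicts the positivity of \<open>g\<close> to the right of
      \<open>c\<close>.\<close>
    define g where "g x = f x - f a - e * (x - a)" for x
    define A where "A = {x \<in> {a..b}. g x \<le> 0}"
    assume "\<not> ?thesis"
    then have gb: "g b > 0" by (simp add: g_def)
    have cg: "continuous_on {a..b} g"
      unfolding g_def by (intro continuous_intros cont)
    have "closed A"
      unfolding A_def using continuous_on_closed_Collect_le[OF cg continuous_on_const[of _ 0]] by simp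
    moreover have "A \<noteq> {}" "bdd_above A"
      using ab by (auto simp: A_def g_def intro!: exI[of _ a] bdd_aboveI[of _ b])
    ultimately have cA: "Sup A \<in> A" by (intro closed_contains_Sup)
    define c where "c = Sup A"
    have c: "a \<le> c" "c \<le> b" "g c \<le> 0" using cA by (auto simp: A_def c_def)
    with gb have "c < b" by (cases "c = b") auto
    have pos: "g x > 0" if "c < x" "x \<le> b" for x
    proof (rule ccontr)
      assume "\<not> ?thesis"
      then have "x \<in> A" using that c by (auto simp: A_def)
      then have "x \<le> c" unfolding c_def by (intro cSup_upper \<open>bdd_above A\<close>)
      with that show False by simp
    qed
    from deriv[OF c(1) \<open>c < b\<close>] e
    have "((\<lambda>h. (f (c + h) - f c) / h) \<longlongrightarrow> f' c) (at_right 0)" "f' c < e" by auto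
    then have "\<forall>\<^sub>F h in at_right 0. (f (c + h) - f c) / h < e"
      by (rule order_tendstoD)
    moreover have "\<forall>\<^sub>F h in at_right 0. h < b - c"
      using \<open>c < b\<close> by (intro eventually_at_right_less[THEN eventually_mono] eventually_at_rightI[of 0 "b - c"]) auto
    moreover have "\<forall>\<^sub>F h in at_right (0::real). 0 < h" by (rule eventually_at_right_less)
    ultimately have "\<forall>\<^sub>F h in at_right (0::real). False"
    proof eventually_elim
      case (elim h)
      then have "f (c + h) - f c < e * h" by (simp add: field_simps)
      then have "g (c + h) < g c" by (simp add: g_def algebra_simps)
      with c(3) pos[of "c + h"] elim show False by simp
    qed
    then show False by simp
  qed
  show ?thesis
  proof (rule field_le_epsilon)
    fix e :: real assume "e > 0"
    then have "e / (b - a + 1) * (b - a) \<le> e" using ab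
      by (simp add: field_simps)
    with *[of "e / (b - a + 1)"] \<open>e > 0\<close> ab show "f b \<le> f a + e" by simp
  qed
qed

text \<open>The antiderivative \<open>F\<close> of \<open>f'\<close> has a two-sided derivative, and
  both \<open>f - F\<close> and \<open>F - f\<close> have right derivative 0. By the preceding lemma
  \<open>f\<close> and \<open>F\<close> differ by a constant.\<close>

lemma DERIV_if_right_derivative_continuous:
  fixes f :: "real \<Rightarrow> real"
  assumes cont: "continuous_on {0..} f" and cont': "continuous_on {0..} f'"
    and deriv: "\<And>x. 0 \<le> x \<Longrightarrow> ((\<lambda>h. (f (x + h) - f x) / h) \<longlongrightarrow> f' x) (at_right 0)"
    and x: "0 < x"
  shows "(f has_real_derivative f' x) (at x)"
proof -
  define F where "F y = integral {0..y} f'" for y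
  have F: "(F has_real_derivative f' y) (at y within {0..b})" if "y \<in> {0..b}" for y b
    unfolding F_def using that
    by (intro integral_has_real_derivative continuous_on_subset[OF cont']) auto
  have F_right: "((\<lambda>h. (F (y + h) - F y) / h) \<longlongrightarrow> f' y) (at_right 0)" if "0 \<le> y" for y
  proof -
    have "(F has_real_derivative f' y) (at y within {y..y+1})"
      by (rule DERIV_subset[OF F[of y "y + 1"]]) (use that in auto)
    then have "((\<lambda>z. (F z - F y) / (z - y)) \<longlongrightarrow> f' y) (at_right y)"
      by (simp add: has_field_derivative_iff at_within_Icc_at_right)
    then show ?thesis
      by (subst (asm) filterlim_at_right_to_0) (simp add: add.commute)
  qed
  have eq: "f y - F y = f 0 - F 0" if "0 \<le> y" for y
  proof -
    have cF: "continuous_on {0..y} F"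
      using F by (intro DERIV_continuous_on) 
    have c: "continuous_on {0..y} f" using cont by (rule continuous_on_subset) auto
    have 1: "((\<lambda>h. ((f (u + h) - F (u + h)) - (f u - F u)) / h) \<longlongrightarrow> 0) (at_right 0)" if "0 \<le> u" for u
      using tendsto_diff[OF deriv[OF that] F_right[OF that]]
      unfolding diff_divide_distrib[symmetric] by (simp add: algebra_simps)
    have 2: "((\<lambda>h. ((F (u + h) - f (u + h)) - (F u - f u)) / h) \<longlongrightarrow> 0) (at_right 0)" if "0 \<le> u" for u
      using tendsto_diff[OF F_right[OF that] deriv[OF that]]
      unfolding diff_divide_distrib[symmetric] by (simp add: algebra_simps)
    have "f y - F y \<le> f 0 - F 0"
      by (rule right_derivative_nonpos_imp_le[where f' = "\<lambda>_. 0", OF that])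
        (auto intro!: continuous_intros c cF 1)
    moreover have "F y - f y \<le> F 0 - f 0"
      by (rule right_derivative_nonpos_imp_le[where f' = "\<lambda>_. 0", OF that])
        (auto intro!: continuous_intros c cF 2)
    ultimately show ?thesis by simp
  qed
  have "(F has_real_derivative f' x) (at x)"
  proof -
    have "at x within {0..x + 1} = at x"
      using x by (intro at_within_interior) simp
    moreover have "x \<in> {0..x + 1}" using x by simp
    ultimately show ?thesis using F[of x "x + 1"] by metis
  qed
  then have 1: "((\<lambda>y. F y + (f 0 - F 0)) has_real_derivative f' x) (at x)"
    by (auto intro!: derivative_eq_intros)
  have 2: "F y + (f 0 - F 0) = f y" if "y \<in> {0<..}" for y
  proof -
    from that have "0 \<le> y" by simp
    from eq[OF this] show ?thesis by linarith
  qed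
  show ?thesis
    by (rule has_field_derivative_transform_within_open[OF 1 open_greaterThan _ 2]) (use x in auto)
qed

section \<open>Transition functions and generators\<close>

lemma abs_integral_le_prob:
  fixes f :: "'a \<Rightarrow> real"
  assumes "prob_space M" "f \<in> borel_measurable M" "\<And>y. y \<in> space M \<Longrightarrow> \<bar>f y\<bar> \<le> B"
  shows "\<bar>\<integral>y. f y \<partial>M\<bar> \<le> B"
proof -
  interpret prob_space M by fact
  have int: "integrable M f"
    using assms by (intro integrable_const_bound[of _ B]) auto
  have "\<integral>y. f y \<partial>M \<le> B" "- B \<le> \<integral>y. f y \<partial>M"
    using assms(3) int by (auto intro!: integral_le_const integral_ge_const simp: abs_le_iff minus_le_iff)
  then show ?thesis by (simp add: abs_le_iff)
qed

lemma transition_functionD: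
  assumes "transition_function E P" "t \<ge> 0" "x \<in> space E"
  shows "prob_space (P t x)" "sets (P t x) = sets E" "space (P t x) = space E"
proof -
  have "P t x \<in> space (prob_algebra E)"
    using assms unfolding transition_function_def by (auto dest: measurable_space)
  then show "prob_space (P t x)" "sets (P t x) = sets E"
    by (auto simp: space_prob_algebra)
  then show "space (P t x) = space E" by (intro sets_eq_imp_space_eq)
qed

lemma transition_function_integral_measurable:
  fixes f :: "'a \<Rightarrow> real"
  assumes P: "transition_function E P" and t: "t \<ge> 0" and f: "f \<in> borel_measurable E"
  shows "(\<lambda>x. \<integral>y. f y \<partial>P t x) \<in> borel_measurable E"
  using P t f unfolding transition_function_def
  by (intro measurable_compose[OF measurable_prob_algebraD integral_measurable_subprob_algebra]) auto

lemma transition_function_integral_add: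
  fixes f :: "'a \<Rightarrow> real"
  assumes P: "transition_function E P" and st: "s \<ge> 0" "t \<ge> 0" and x: "x \<in> space E"
    and f: "f \<in> borel_measurable E" and B: "\<And>y. y \<in> space E \<Longrightarrow> \<bar>f y\<bar> \<le> B"
  shows "(\<integral>y. f y \<partial>P (s + t) x) = (\<integral>y. (\<integral>w. f w \<partial>P t y) \<partial>P s x)"
proof -
  note Ps = transition_functionD[OF P st(1) x]
  interpret prob_space "P s x" by (rule Ps)
  have "P (s + t) x = P s x \<bind> P t"
    using P st x by (auto simp: transition_function_def)
  moreover have "P t \<in> P s x \<rightarrow>\<^sub>M subprob_algebra E"
    using P st Ps(2) by (auto simp: transition_function_def intro!: measurable_prob_algebraD cong: measurable_cong_sets)
  moreover have "AE y in P s x. emeasure (P t y) (space (P t y)) \<le> ennreal 1"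
    using transition_functionD(1)[OF P st(2)] Ps(3) by (intro AE_I2) (simp add: prob_space.emeasure_space_1)
  ultimately show ?thesis
    using integral_bind[of f E B "P t" "P s x" 1] f B finite_measure_axioms by simp
qed

lemma generator_abs_le:
  assumes P: "transition_function E P" and G: "has_generator E P D A" and f: "f \<in> D"
  obtains C where "\<And>t x. t > 0 \<Longrightarrow> x \<in> space E \<Longrightarrow> \<bar>(\<integral>y. f y \<partial>P t x) - f x\<bar> \<le> C * t"
    "\<And>x. x \<in> space E \<Longrightarrow> \<bar>A f x\<bar> \<le> C"
proof -
  from G f obtain C where C: "\<And>t x. t > 0 \<Longrightarrow> x \<in> space E \<Longrightarrow> \<bar>((\<integral>y. f y \<partial>P t x) - f x) / t\<bar> \<le> C"
    and lim: "\<And>x. x \<in> space E \<Longrightarrow> ((\<lambda>t. ((\<integral>y. f y \<partial>P t x) - f x) / t) \<longlongrightarrow> A f x) (at_right 0)"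
    unfolding has_generator_def by blast
  have "\<bar>A f x\<bar> \<le> C" if "x \<in> space E" for x
    using tendsto_rabs[OF lim[OF that]]
    by (rule tendsto_upperbound) (use C that in \<open>auto intro!: eventually_at_rightI[of 0 1]\<close>)
  moreover have "\<bar>(\<integral>y. f y \<partial>P t x) - f x\<bar> \<le> C * t" if "t > 0" "x \<in> space E" for t x
    using C[OF that] that by (simp add: field_simps)
  ultimately show thesis using that by blast
qed

text \<open>By the semigroup property the difference quotient at time \<open>t\<close> is the
  average under \<open>P t x\<close> of the quotients \<open>q h\<close> at time 0, so their bounded
  pointwise convergence passes to time \<open>t\<close> by dominated convergence. The uniform bound
  on \<open>q h\<close> is at the same time a Lipschitz constant in time.\<close>

lemma semigroup_derivative:
  assumes P: "transition_function E P" and G: "has_generator E P D A" and fD: "f \<in> D"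
    and f: "f \<in> borel_measurable E" and bound: "\<forall>y\<in>space E. \<bar>f y\<bar> \<le> B"
    and Af: "A f \<in> borel_measurable E" and x: "x \<in> space E"
  shows semigroup_right_derivative: "\<And>t. t \<ge> 0 \<Longrightarrow>
      ((\<lambda>h. ((\<integral>y. f y \<partial>P (t + h) x) - (\<integral>y. f y \<partial>P t x)) / h) \<longlongrightarrow> (\<integral>y. A f y \<partial>P t x)) (at_right 0)"
    and semigroup_continuous: "continuous_on {0..} (\<lambda>t. \<integral>y. f y \<partial>P t x)"
proof -
  have B: "\<bar>f y\<bar> \<le> B" if "y \<in> space E" for y using bound that by blast
  from generator_abs_le[OF P G fD] obtain C
    where C: "\<And>t x. t > 0 \<Longrightarrow> x \<in> space E \<Longrightarrow> \<bar>(\<integral>y. f y \<partial>P t x) - f x\<bar> \<le> C * t" by metis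
  define q where "q h y = ((\<integral>w. f w \<partial>P h y) - f y) / h" for h y
  have q: "\<bar>q h y\<bar> \<le> C" if "h > 0" "y \<in> space E" for h y
    using C[OF that] that by (simp add: q_def field_simps)
  have q_meas: "q h \<in> borel_measurable E" if "h > 0" for h
    unfolding q_def using that
    by (intro borel_measurable_divide borel_measurable_diff transition_function_integral_measurable[OF P] f) auto
  have q_lim: "((\<lambda>h. q h y) \<longlongrightarrow> A f y) (at_right 0)" if "y \<in> space E" for y
    using G fD that unfolding has_generator_def q_def by blast
  have diff: "((\<integral>y. f y \<partial>P (t + h) x) - (\<integral>y. f y \<partial>P t x)) / h = (\<integral>y. q h y \<partial>P t x)"
    if t: "t \<ge> 0" and h: "h > 0" for t h
  proof -
    note Pt = transition_functionD[OF P t x]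
    interpret prob_space "P t x" by (rule Pt)
    have m1: "(\<lambda>y. \<integral>w. f w \<partial>P h y) \<in> borel_measurable (P t x)" and m2: "f \<in> borel_measurable (P t x)"
      using f transition_function_integral_measurable[OF P _ f, of h] h Pt(2)
      by (auto cong: measurable_cong_sets)
    have B': "\<bar>\<integral>w. f w \<partial>P h y\<bar> \<le> B" if "y \<in> space E" for y
      using transition_functionD[OF P _ that, of h] h f B
      by (intro abs_integral_le_prob) (auto cong: measurable_cong_sets)
    have "integrable (P t x) f" "integrable (P t x) (\<lambda>y. \<integral>w. f w \<partial>P h y)"
      using m1 m2 B B' by (auto intro!: integrable_const_bound[of _ B] simp: Pt(3))
    moreover have "(\<integral>y. f y \<partial>P (t + h) x) = (\<integral>y. (\<integral>w. f w \<partial>P h y) \<partial>P t x)"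
      by (rule transition_function_integral_add[OF P t _ x f B]) (use h in auto)
    ultimately show ?thesis by (simp add: q_def)
  qed
  show "((\<lambda>h. ((\<integral>y. f y \<partial>P (t + h) x) - (\<integral>y. f y \<partial>P t x)) / h) \<longlongrightarrow> (\<integral>y. A f y \<partial>P t x)) (at_right 0)"
    if t: "t \<ge> 0" for t
    unfolding tendsto_at_iff_sequentially comp_def
  proof safe
    fix X :: "nat \<Rightarrow> real" assume X: "\<forall>i. X i \<in> {0<..} - {0}" "X \<longlonglongrightarrow> 0"
    note Pt = transition_functionD[OF P t x]
    interpret prob_space "P t x" by (rule Pt)
    have "(\<lambda>n. \<integral>y. q (X n) y \<partial>P t x) \<longlonglongrightarrow> (\<integral>y. A f y \<partial>P t x)"
    proof (rule integral_dominated_convergence[where w = "\<lambda>_. C"])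
      show "AE y in P t x. (\<lambda>i. q (X i) y) \<longlonglongrightarrow> A f y"
      proof (rule AE_I2)
        fix y assume "y \<in> space (P t x)"
        with q_lim[of y] X Pt(3) show "(\<lambda>i. q (X i) y) \<longlonglongrightarrow> A f y"
          by (auto simp: tendsto_at_iff_sequentially comp_def)
      qed
    next
      have meas: "g \<in> borel_measurable (P t x) \<longleftrightarrow> g \<in> borel_measurable E" for g :: "'a \<Rightarrow> real"
        by (intro arg_cong2[where f = "(\<in>)"] refl measurable_cong_sets Pt(2))
      show "A f \<in> borel_measurable (P t x)" using Af by (simp add: meas)
      show "q (X i) \<in> borel_measurable (P t x)" for i
        using q_meas[of "X i"] X(1) by (simp add: meas)
      show "AE y in P t x. norm (q (X i) y) \<le> C" for i
        using q[of "X i"] X(1) Pt(3) by (intro AE_I2) auto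
    qed simp
    then show "(\<lambda>n. ((\<integral>y. f y \<partial>P (t + X n) x) - (\<integral>y. f y \<partial>P t x)) / X n) \<longlonglongrightarrow> (\<integral>y. A f y \<partial>P t x)"
      using X by (simp add: diff[OF t])
  qed
  have lip: "\<bar>(\<integral>y. f y \<partial>P u x) - (\<integral>y. f y \<partial>P t x)\<bar> \<le> C * \<bar>u - t\<bar>" if "0 \<le> t" "t \<le> u" for t u
  proof (cases "t = u")
    case False
    define h where "h = u - t"
    with False that have h: "h > 0" "u = t + h" by auto
    note Pt = transition_functionD[OF P \<open>0 \<le> t\<close> x]
    have "\<bar>\<integral>y. q h y \<partial>P t x\<bar> \<le> C"
      using h Pt q[of h] q_meas[of h] by (intro abs_integral_le_prob) (auto cong: measurable_cong_sets)
    then have "\<bar>((\<integral>y. f y \<partial>P u x) - (\<integral>y. f y \<partial>P t x)) / h\<bar> \<le> C"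
      using diff[OF \<open>0 \<le> t\<close> h(1)] h by simp
    then show ?thesis using h by (simp add: field_simps)
  qed auto
  have "0 \<le> C" using C[of 1 x] x by linarith
  have "C-lipschitz_on {0..} (\<lambda>t. \<integral>y. f y \<partial>P t x)"
  proof (rule lipschitz_onI)
    fix t u :: real assume "t \<in> {0..}" "u \<in> {0..}"
    then show "dist (\<integral>y. f y \<partial>P t x) (\<integral>y. f y \<partial>P u x) \<le> C * dist t u"
      using lip[of t u] lip[of u t] by (cases "t \<le> u") (auto simp: dist_real_def abs_minus_commute)
  qed fact
  then show "continuous_on {0..} (\<lambda>t. \<integral>y. f y \<partial>P t x)"
    by (rule lipschitz_on_continuous_on)
qed

text \<open>The Markov property is used from time 0: as \<open>X 0\<close> is almost surely
  \<open>x\<close>, the conditional probability given the initial sigma-algebra is almost surely the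
  constant \<open>measure (P t x) B\<close>, and integrating it gives the law. One-time expectations
  thereby become integrals against the transition function.\<close>

lemma markov_process_distr:
  assumes P: "transition_function E P" and X: "markov_process M E P x X" and t: "t \<ge> 0" and x: "x \<in> space E"
  shows "distr M E (X t) = P t x"
proof (rule measure_eqI)
  interpret prob_space M using X by (simp add: markov_process_def)
  note Pt = transition_functionD[OF P t x]
  interpret Pt: prob_space "P t x" by (rule Pt)
  have X_meas: "X u \<in> M \<rightarrow>\<^sub>M E" if "u \<ge> 0" for u using X that by (simp add: markov_process_def)
  note [measurable] = X_meas[OF t]
  show "sets (distr M E (X t)) = sets (P t x)" using Pt by simp
  interpret F: finite_measure_subalgebra M "natural_filtration M E X 0"
  proof
    have *: "{X u -` B \<inter> space M | u B. 0 \<le> u \<and> u \<le> 0 \<and> B \<in> sets E} \<subseteq> sets M"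
      using X_meas by (auto intro: measurable_sets)
    with sets.space_closed[of M] show "subalgebra M (natural_filtration M E X 0)"
      unfolding natural_filtration_def subalgebra_def
      by (subst space_measure_of) (auto intro!: sets.sigma_sets_subset simp: sets_measure_of)
  qed
  fix B assume "B \<in> sets (distr M E (X t))"
  then have B[measurable]: "B \<in> sets E" by simp
  let ?f = "\<lambda>\<omega>. indicator B (X t \<omega>) :: real"
  have int: "integrable M ?f" by (intro integrable_const_bound[of _ 1]) auto
  have "AE \<omega> in M. real_cond_exp M (natural_filtration M E X 0) ?f \<omega> = measure (P t (X 0 \<omega>)) B"
    using X[unfolded markov_process_def, THEN conjunct2, THEN conjunct2, THEN conjunct2, rule_format, of 0 t B]
      t B by simp
  moreover have "AE \<omega> in M. X 0 \<omega> = x" using X by (simp add: markov_process_def)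
  ultimately have "AE \<omega> in M. real_cond_exp M (natural_filtration M E X 0) ?f \<omega> = measure (P t x) B"
    by eventually_elim simp
  then have "(\<integral>\<omega>. real_cond_exp M (natural_filtration M E X 0) ?f \<omega> \<partial>M) = (\<integral>\<omega>. measure (P t x) B \<partial>M)"
    by (intro integral_cong_AE) auto
  then have "(\<integral>\<omega>. ?f \<omega> \<partial>M) = measure (P t x) B"
    using F.real_cond_exp_int(2)[OF int] by (simp add: prob_space)
  moreover have "(\<integral>\<omega>. ?f \<omega> \<partial>M) = measure (distr M E (X t)) B"
    by (subst integral_distr[symmetric, where N = E]) auto
  ultimately show "emeasure (distr M E (X t)) B = emeasure (P t x) B"
    using prob_space.finite_measure[OF prob_space_distr[OF X_meas[OF t]]]
    by (simp add: Pt.emeasure_eq_measure finite_measure.emeasure_eq_measure)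
qed

section \<open>Calculus on the half line\<close>

lemma at_within_atLeast_nontrivial: "0 \<le> (z::real) \<Longrightarrow> at z within {0..} \<noteq> bot"
  using not_trivial_limit_within_ball[of z "{0..}"] 
  by (metis at_within_Icc_at_right at_le Icc_subset_Ici_iff add.commute bot.extremum_unique le_add_same_cancel2 less_add_one trivial_limit_at_right_real order_refl zero_less_one_class.zero_le_one)

lemma hderiv_eqI:
  assumes "(f has_real_derivative D) (at z within {0..})" "0 \<le> z"
  shows "hderiv f z = D"
  unfolding hderiv_def
  using assms at_within_atLeast_nontrivial
  by (auto intro!: vector_derivative_within simp: has_real_derivative_iff_has_vector_derivative)

lemma C1_half_lineI:
  assumes "\<And>z. 0 \<le> z \<Longrightarrow> (f has_real_derivative f' z) (at z within {0..})" "continuous_on {0..} f'"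
  shows "f \<in> C1_half_line"
proof -
  have "continuous_on {0..} (hderiv f) \<longleftrightarrow> continuous_on {0..} f'"
    using assms(1) by (intro continuous_on_cong refl) (auto intro: hderiv_eqI)
  moreover have "f differentiable_on {0..}"
    using assms(1) by (auto simp: differentiable_on_def real_differentiable_def)
  ultimately show ?thesis using assms(2) by (simp add: C1_half_line_def)
qed

lemma C2_half_lineI:
  assumes f': "\<And>z. 0 \<le> z \<Longrightarrow> (f has_real_derivative f' z) (at z within {0..})"
    and f'': "\<And>z. 0 \<le> z \<Longrightarrow> (f' has_real_derivative f'' z) (at z within {0..})"
    and cont: "continuous_on {0..} f''"
  shows "f \<in> C2_half_line" and "\<And>z. 0 \<le> z \<Longrightarrow> hderiv (hderiv f) z = f'' z"
proof -
  have *: "(hderiv f has_real_derivative f'' z) (at z within {0..})" if "0 \<le> z" for z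
    using f''[OF that] by (rule has_field_derivative_transform_within[OF _ zero_less_one])
      (use that in \<open>auto intro: hderiv_eqI[OF f', symmetric]\<close>)
  show "hderiv (hderiv f) z = f'' z" if "0 \<le> z" for z
    using *[OF that] that by (rule hderiv_eqI)
  have "f differentiable_on {0..}"
    using f' by (auto simp: differentiable_on_def real_differentiable_def)
  then show "f \<in> C2_half_line"
    using C1_half_lineI[OF * cont] by (simp add: C2_half_line_def)
qed

lemma linear_ode_solution:
  fixes u :: "real \<Rightarrow> real"
  assumes cont: "continuous_on {0..} u" and deriv: "\<And>t. t > 0 \<Longrightarrow> (u has_real_derivative c * u t) (at t)"
    and t: "t \<ge> 0"
  shows "u t = u 0 * exp (c * t)"
proof (cases "t = 0")
  case False
  define g where "g r = u r * exp (- c * r)" for r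
  have "g t = g 0"
  proof (rule DERIV_isconst_end[of 0 t g])
    show "continuous_on {0..t} g"
      unfolding g_def by (intro continuous_intros continuous_on_subset[OF cont]) auto
    show "(g has_real_derivative 0) (at r)" if "0 < r" "r < t" for r
      unfolding g_def using deriv[OF that(1)] by (auto intro!: derivative_eq_intros)
  qed (use t False in auto)
  then show ?thesis by (simp add: g_def exp_minus field_simps)
qed simp

section \<open>The flow of the deterministic component\<close>

text \<open>The flow of \<open>S' = - S (\<beta> + S) / 2\<close>; it is linear in the coordinate \<open>S / (\<beta> + S)\<close>.\<close>

definition sflow :: "real \<Rightarrow> real \<Rightarrow> real \<Rightarrow> real" where
  "sflow \<beta> s t = \<beta> * s * exp (- \<beta> * t / 2) / (\<beta> + s * (1 - exp (- \<beta> * t / 2)))"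

context
  fixes \<beta> :: real
  assumes \<beta>: "\<beta> > 0"
begin

lemma sflow_denominator_pos:
  assumes "s \<ge> 0" "t \<ge> 0"
  shows "\<beta> + s * (1 - exp (- \<beta> * t / 2)) > 0"
  using assms \<beta> by (intro add_pos_nonneg mult_nonneg_nonneg) auto

lemma sflow_0 [simp]: "sflow \<beta> s 0 = s"
  using \<beta> by (simp add: sflow_def)

lemma sflow_nonneg: "s \<ge> 0 \<Longrightarrow> t \<ge> 0 \<Longrightarrow> sflow \<beta> s t \<ge> 0"
  unfolding sflow_def using sflow_denominator_pos[of s t] \<beta> by (intro divide_nonneg_pos) auto

lemma sflow_pos: "s > 0 \<Longrightarrow> t \<ge> 0 \<Longrightarrow> sflow \<beta> s t > 0"
  unfolding sflow_def using sflow_denominator_pos[of s t] \<beta> by (intro divide_pos_pos) auto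

lemma add_sflow:
  assumes "s \<ge> 0" "t \<ge> 0"
  shows "\<beta> + sflow \<beta> s t = \<beta> * (\<beta> + s) / (\<beta> + s * (1 - exp (- \<beta> * t / 2)))"
  unfolding sflow_def using sflow_denominator_pos[OF assms] by (simp add: field_simps)

lemma sflow_linearized:
  assumes "s \<ge> 0" "t \<ge> 0"
  shows "sflow \<beta> s t / (\<beta> + sflow \<beta> s t) = s / (\<beta> + s) * exp (- \<beta> * t / 2)"
  unfolding add_sflow[OF assms] unfolding sflow_def
  using sflow_denominator_pos[OF assms] assms \<beta> by simp

lemma sflow_has_derivative:
  assumes "s \<ge> 0" "t \<ge> 0"
  shows "(sflow \<beta> s has_real_derivative - 1/2 * sflow \<beta> s t * (\<beta> + sflow \<beta> s t)) (at t)"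
proof -
  define e where "e = exp (- \<beta> * t / 2)"
  define d where "d = \<beta> + s * (1 - e)"
  have d: "d > 0" using sflow_denominator_pos[OF assms] by (simp add: d_def e_def)
  have "(sflow \<beta> s has_real_derivative
      (\<beta> * s * (- \<beta> / 2 * e) * d - \<beta> * s * e * (s * (\<beta> / 2 * e))) / (d * d)) (at t)"
    unfolding sflow_def[abs_def] d_def e_def using sflow_denominator_pos[OF assms]
    by (auto intro!: derivative_eq_intros simp: field_simps)
  moreover have "(\<beta> * s * (- \<beta> / 2 * e) * d - \<beta> * s * e * (s * (\<beta> / 2 * e))) / (d * d) =
      - 1/2 * (\<beta> * s * e / d) * (\<beta> * (\<beta> + s) / d)"
    by (simp add: d_def algebra_simps diff_divide_distrib add_divide_distrib)
  ultimately show ?thesis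
    unfolding add_sflow[OF assms] unfolding sflow_def d_def e_def by simp
qed

lemma sflow_continuous: "s \<ge> 0 \<Longrightarrow> continuous_on {0..} (sflow \<beta> s)"
  using sflow_has_derivative
  by (intro continuous_at_imp_continuous_on ballI) (auto intro: DERIV_isCont)

text \<open>The difference of the two flows is exactly
  \<open>(\<beta> * \<beta>) / (d * c) * (e * x)\<close> with both denominators at least
  \<open>\<beta>\<close>, hence a factor in the unit interval times \<open>e\<close>. This is the
  error caused later by shifting the start of the flow.\<close>

lemma sflow_diff:
  assumes "s \<ge> 0" "t \<ge> 0" "e \<ge> 0"
  shows "sflow \<beta> s t \<le> sflow \<beta> (s + e) t" and "sflow \<beta> (s + e) t \<le> sflow \<beta> s t + e"
proof -
  define x where "x = exp (- \<beta> * t / 2)"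
  have x: "0 < x" "x \<le> 1" using assms \<beta> by (auto simp: x_def)
  define c where "c = \<beta> + s * (1 - x)"
  define d where "d = \<beta> + (s + e) * (1 - x)"
  have c: "c \<ge> \<beta>" "d \<ge> \<beta>" using x assms by (auto simp: c_def d_def)
  have "sflow \<beta> (s + e) t - sflow \<beta> s t = \<beta> * (s + e) * x / d - \<beta> * s * x / c"
    by (simp add: sflow_def x_def c_def d_def)
  also have "\<dots> = (\<beta> * (s + e) * x * c - \<beta> * s * x * d) / (d * c)"
    using c \<beta> by (intro diff_frac_eq) auto
  also have "\<beta> * (s + e) * x * c - \<beta> * s * x * d = (\<beta> * \<beta>) * (e * x)"
    by (simp add: c_def d_def algebra_simps)
  finally have eq: "sflow \<beta> (s + e) t - sflow \<beta> s t = (\<beta> * \<beta>) / (d * c) * (e * x)" by simp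
  have "\<beta> * \<beta> \<le> d * c" using c \<beta> by (intro mult_mono) auto
  then have r: "0 \<le> (\<beta> * \<beta>) / (d * c)" "(\<beta> * \<beta>) / (d * c) \<le> 1"
    using c \<beta> by (auto simp: divide_le_eq)
  show "sflow \<beta> s t \<le> sflow \<beta> (s + e) t"
    using eq r(1) x assms by (smt (verit) mult_nonneg_nonneg)
  have "(\<beta> * \<beta>) / (d * c) * (e * x) \<le> 1 * (e * 1)"
    using r x assms by (intro mult_mono) auto
  then show "sflow \<beta> (s + e) t \<le> sflow \<beta> s t + e" using eq by simp
qed

end

section \<open>Test functions for the dual process\<close>

lemma space_dual_space: "space dual_space = UNIV \<times> {0..}"
  by (simp add: dual_space_def space_pair_measure space_restrict_space)

lemma dual_space_snd_measurable [measurable (raw)]: "snd \<in> borel_measurable dual_space"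
proof -
  have "snd \<in> dual_space \<rightarrow>\<^sub>M half_line" by (simp add: dual_space_def)
  then show ?thesis unfolding measurable_restrict_space2_iff by (rule conjunct1)
qed

lemma dual_space_fst_measurable [measurable (raw)]:
  "fst \<in> dual_space \<rightarrow>\<^sub>M count_space UNIV"
  by (simp add: dual_space_def)

text \<open>The factor \<open>total m\<close> cancels against the jump weights
  \<open>m $ i / total m\<close>. This includes \<open>total m = 0\<close>, where every
  \<open>m $ i\<close> is 0, so the division by zero does no harm.\<close>

lemma dual_gen_product:
  fixes \<phi> :: "nat ^ 'n \<Rightarrow> real"
  assumes "(b has_real_derivative b') (at s within {0..})" "0 \<le> s"
  shows "dual_gen \<beta> (\<lambda>(m, s). \<phi> m * b s) (m, s) =
    1/2 * (\<beta> + s) * b s * (\<Sum>i\<in>UNIV. real (m $ i) * (\<phi> (m - axis i 1) - \<phi> m))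
      - 1/2 * s * (\<beta> + s) * (\<phi> m * b')"
proof -
  have 1: "hderiv (\<lambda>r. \<phi> m * b r) s = \<phi> m * b'"
    using assms by (intro hderiv_eqI) (auto intro!: derivative_eq_intros)
  have 2: "real (total m) * (real (m $ i) / real (total m)) = real (m $ i)" for i
  proof (cases "total m = 0")
    case True
    then show ?thesis by (simp add: total_def)
  qed simp
  have 3: "real (total m) * (\<Sum>i\<in>UNIV. real (m $ i) / real (total m) * (\<phi> (m - axis i 1) * b s - \<phi> m * b s))
    = (\<Sum>i\<in>UNIV. real (m $ i) * (\<phi> (m - axis i 1) - \<phi> m)) * b s"
    unfolding sum_distrib_left sum_distrib_right
    by (intro sum.cong refl) (simp only: mult.assoc[symmetric] 2 left_diff_distrib right_diff_distrib)
  have "dual_gen \<beta> (\<lambda>(m, s). \<phi> m * b s) (m, s) = 1/2 * (\<beta> + s) * (real (total m) *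
      (\<Sum>i\<in>UNIV. real (m $ i) / real (total m) * (\<phi> (m - axis i 1) * b s - \<phi> m * b s)))
      - 1/2 * s * (\<beta> + s) * (\<phi> m * b')"
    unfolding dual_gen_def by (simp only: prod.case 1 mult_ac)
  then show ?thesis unfolding 3 by (simp only: mult_ac)
qed

text \<open>The hypothesis keeps the subtraction on natural numbers from truncating. The lemma turns
  jumps into \<open>k\<close> into the indicator of the predecessor
  \<open>k + axis i 1\<close>.\<close>

lemma nat_vec_diff_axis_eq_iff:
  fixes k m :: "nat ^ 'n"
  assumes "m $ i > 0"
  shows "m - axis i 1 = k \<longleftrightarrow> m = k + axis i 1"
  using assms by (auto simp: vec_eq_iff axis_def)

text \<open>The factor \<open>1\<close> is the constant function of \<open>m\<close>, as required by \<open>dual_gen_product\<close>.\<close>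

definition vcoord :: "real \<Rightarrow> nat \<Rightarrow> (nat ^ 'n) \<times> real \<Rightarrow> real" where
  "vcoord \<beta> j = (\<lambda>(m, s). 1 * (s / (\<beta> + s)) ^ j)"

text \<open>The factor \<open>\<beta> / (\<beta> + s)\<close> compensates the jump rate, which is
  proportional to \<open>\<beta> + s\<close>. For a bare indicator the image under the generator
  would be unbounded in \<open>s\<close>, and the function would fall outside
  \<open>dual_domain\<close>.\<close>

definition dual_test :: "real \<Rightarrow> nat ^ 'n \<Rightarrow> (nat ^ 'n) \<times> real \<Rightarrow> real" where
  "dual_test \<beta> k = (\<lambda>(m, s). indicator {k} m * (\<beta> / (\<beta> + s)))"

context
  fixes \<beta> :: real
  assumes \<beta>: "\<beta> > 0"
begin

lemma vcoord_derivative: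
  assumes "0 \<le> s"
  shows "((\<lambda>s. (s / (\<beta> + s)) ^ j) has_real_derivative real j * (s / (\<beta> + s)) ^ (j - 1) * (\<beta> / (\<beta> + s)\<^sup>2))
    (at s within {0..})"
proof -
  have "((\<lambda>s. s / (\<beta> + s)) has_real_derivative \<beta> / (\<beta> + s)\<^sup>2) (at s within {0..})"
    using assms \<beta> by (auto intro!: derivative_eq_intros simp: power2_eq_square)
  from DERIV_power[OF this, of j] show ?thesis by (simp add: mult_ac)
qed

text \<open>The jump part vanishes, as nothing depends on \<open>m\<close>, and in the coordinate
  \<open>u = s / (\<beta> + s)\<close> the drift becomes linear, namely
  \<open>- \<beta> / 2 * u\<close>.\<close>

lemma dual_gen_vcoord:
  assumes "0 \<le> s"
  shows "dual_gen \<beta> (vcoord \<beta> j) (m, s) = - (real j * \<beta> / 2) * vcoord \<beta> j (m, s)"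
proof -
  have "dual_gen \<beta> (vcoord \<beta> j) (m, s) =
      - 1/2 * s * (\<beta> + s) * (real j * (s / (\<beta> + s)) ^ (j - 1) * (\<beta> / (\<beta> + s)\<^sup>2))"
    unfolding vcoord_def by (subst dual_gen_product[OF vcoord_derivative[OF assms] assms]) simp
  also have "\<dots> = - (real j * \<beta> / 2) * ((s / (\<beta> + s)) * (s / (\<beta> + s)) ^ (j - 1))"
    using assms \<beta> by (simp add: power2_eq_square)
  also have "\<dots> = - (real j * \<beta> / 2) * vcoord \<beta> j (m, s)"
    by (cases j) (simp_all add: vcoord_def)
  finally show ?thesis .
qed

lemma vcoord_bounds:
  assumes "0 \<le> s"
  shows "\<bar>vcoord \<beta> j (m, s)\<bar> \<le> 1"
  using assms \<beta> by (auto simp: vcoord_def abs_mult power_abs intro!: power_le_one)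

lemma vcoord_in_domain: "(vcoord \<beta> j :: (nat ^ 'n) \<times> real \<Rightarrow> real) \<in> dual_domain \<beta>"
proof -
  have "(\<lambda>r. vcoord \<beta> j (m, r)) \<in> C1_half_line" for m :: "nat ^ 'n"
    unfolding vcoord_def prod.case mult_1_left
    by (rule C1_half_lineI[OF vcoord_derivative]) (use \<beta> in \<open>auto intro!: continuous_intros\<close>)
  moreover have "bounded (vcoord \<beta> j ` (UNIV \<times> {0..} :: ((nat ^ 'n) \<times> real) set))"
    using vcoord_bounds by (auto intro!: boundedI[of _ 1])
  moreover have "bounded (dual_gen \<beta> (vcoord \<beta> j) ` (UNIV \<times> {0..} :: ((nat ^ 'n) \<times> real) set))"
    using vcoord_bounds \<beta>
    by (auto intro!: boundedI[of _ "real j * \<beta> / 2"] mult_left_le simp: dual_gen_vcoord abs_mult)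
  ultimately show ?thesis by (simp add: dual_domain_def)
qed

lemma dual_test_derivative:
  assumes "0 \<le> s"
  shows "((\<lambda>s. \<beta> / (\<beta> + s)) has_real_derivative - \<beta> / (\<beta> + s)\<^sup>2) (at s within {0..})"
  using assms \<beta> by (auto intro!: derivative_eq_intros simp: power2_eq_square)

text \<open>State \<open>k\<close> is entered from \<open>k + axis i 1\<close>, whose
  \<open>i\<close>th entry is \<open>k $ i + 1\<close>; this gives the gain and loss terms of a
  forward equation. The last summand is the drift acting on
  \<open>\<beta> / (\<beta> + s)\<close>.\<close>

lemma dual_gen_dual_test:
  assumes "0 \<le> s"
  shows "dual_gen \<beta> (dual_test \<beta> k) (m, s) =
    \<beta> / 2 * (\<Sum>i\<in>UNIV. real (k $ i + 1) * indicator {k + axis i 1} m - real (k $ i) * indicator {k} m)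
      + \<beta> / 2 * (indicator {k} m * (s / (\<beta> + s)))"
proof -
  have 1: "real (m $ i) * (indicator {k} (m - axis i 1) - indicator {k} m) =
      real (k $ i + 1) * indicator {k + axis i 1} m - real (k $ i) * indicator {k} m" for i
  proof (cases "m $ i = 0")
    case True
    then have "m \<noteq> k + axis i 1" by auto
    with True show ?thesis by (auto simp: indicator_def)
  next
    case False
    then show ?thesis
      using nat_vec_diff_axis_eq_iff[of m i k] by (auto simp: indicator_def)
  qed
  have 2: "1/2 * (\<beta> + s) * (\<beta> / (\<beta> + s)) = \<beta> / 2"
    using assms \<beta> by (simp add: field_simps)
  have 3: "1/2 * s * (\<beta> + s) * (c * (- \<beta> / (\<beta> + s)\<^sup>2)) = - (\<beta> / 2 * (c * (s / (\<beta> + s))))" for c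
    using assms \<beta> by (simp add: power2_eq_square)
  show ?thesis
    unfolding dual_test_def dual_gen_product[OF dual_test_derivative[OF assms] assms] 1 2 3 by simp
qed

lemma dual_gen_dual_test_le:
  fixes k m :: "nat ^ 'n"
  assumes "0 \<le> s"
  shows "\<bar>dual_gen \<beta> (dual_test \<beta> k) (m, s)\<bar> \<le> \<beta> / 2 * (\<Sum>i\<in>UNIV. real (k $ i + 1) + real (k $ i)) + \<beta> / 2"
proof -
  have 1: "\<bar>\<Sum>i\<in>UNIV. real (k $ i + 1) * indicator {k + axis i 1} m - real (k $ i) * indicator {k} m\<bar>
      \<le> (\<Sum>i\<in>UNIV. real (k $ i + 1) + real (k $ i))"
    by (intro order.trans[OF sum_abs] sum_mono) (auto simp: indicator_def)
  have 2: "\<bar>indicator {k} m * (s / (\<beta> + s))\<bar> \<le> 1"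
    using assms \<beta> by (auto simp: indicator_def)
  have 3: "\<bar>\<beta> / 2 * x + \<beta> / 2 * y\<bar> \<le> \<beta> / 2 * a + \<beta> / 2" if "\<bar>x\<bar> \<le> a" "\<bar>y\<bar> \<le> 1" for x y a :: real
  proof -
    have "\<beta> / 2 * \<bar>x + y\<bar> \<le> \<beta> / 2 * (a + 1)"
      using that \<beta> by (intro mult_left_mono) auto
    moreover have "\<beta> / 2 * \<bar>x + y\<bar> = \<bar>\<beta> / 2 * x + \<beta> / 2 * y\<bar>"
      using \<beta> unfolding distrib_left[symmetric] by (simp only: abs_mult abs_of_pos half_gt_zero)
    ultimately show ?thesis by (simp add: distrib_left)
  qed
  show ?thesis unfolding dual_gen_dual_test[OF assms] by (rule 3[OF 1 2])
qed

lemma dual_test_bounds: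
  assumes "0 \<le> s"
  shows "\<bar>dual_test \<beta> k (m, s)\<bar> \<le> 1"
  using assms \<beta> by (auto simp: dual_test_def indicator_def)

lemma dual_test_in_domain: "dual_test \<beta> k \<in> dual_domain \<beta>"
proof -
  have "(\<lambda>r. dual_test \<beta> k (m, r)) \<in> C1_half_line" for m
    unfolding dual_test_def prod.case using \<beta>
    by (intro C1_half_lineI[where f' = "\<lambda>s. indicator {k} m * (- \<beta> / (\<beta> + s)\<^sup>2)"] DERIV_cmult dual_test_derivative)
      (auto intro!: continuous_intros)
  moreover have "bounded (dual_test \<beta> k ` (UNIV \<times> {0..}))"
    using dual_test_bounds by (auto intro!: boundedI[of _ 1])
  moreover have "bounded (dual_gen \<beta> (dual_test \<beta> k) ` (UNIV \<times> {0..}))"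
    using dual_gen_dual_test_le by (intro boundedI) auto
  ultimately show ?thesis by (simp add: dual_domain_def)
qed

end

section \<open>The law of the dual process\<close>

locale dual_transition =
  fixes \<beta> :: real and Q :: "real \<Rightarrow> (nat ^ 'n) \<times> real \<Rightarrow> ((nat ^ 'n) \<times> real) measure"
    and m :: "nat ^ 'n" and s :: real
  assumes \<beta>: "\<beta> > 0" and s: "s \<ge> 0"
    and Q: "transition_function dual_space Q"
    and gen: "has_generator dual_space Q (dual_domain \<beta>) (dual_gen \<beta>)"
begin

definition law :: "real \<Rightarrow> nat ^ 'n \<Rightarrow> real" where
  "law t k = measure (Q t (m, s)) ({k} \<times> {0..})"

lemma start_in_space: "(m, s) \<in> space dual_space"
  using s by (simp add: space_dual_space)

lemmas QD = transition_functionD[OF Q _ start_in_space]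

lemma measurable_Q: "t \<ge> 0 \<Longrightarrow> borel_measurable (Q t (m, s)) = borel_measurable dual_space"
  by (intro measurable_cong_sets QD refl)

lemma measurable_snd [measurable]: "t \<ge> 0 \<Longrightarrow> snd \<in> borel_measurable (Q t (m, s))"
  by (simp add: measurable_Q dual_space_snd_measurable)

lemma vcoord_measurable: "vcoord \<beta> j \<in> borel_measurable dual_space"
  unfolding vcoord_def case_prod_unfold
  by (intro borel_measurable_times borel_measurable_power borel_measurable_divide borel_measurable_add
      borel_measurable_const dual_space_snd_measurable)

lemma indicator_fst_measurable: "(\<lambda>x. indicator {k} (fst x) :: real) \<in> borel_measurable dual_space"
  by (rule measurable_compose[OF dual_space_fst_measurable]) simp

lemma dual_test_measurable: "dual_test \<beta> k \<in> borel_measurable dual_space"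
  unfolding dual_test_def case_prod_unfold
  by (intro borel_measurable_times borel_measurable_divide borel_measurable_add
      borel_measurable_const dual_space_snd_measurable indicator_fst_measurable)

lemma vcoord_moment:
  assumes t: "t \<ge> 0"
  shows "(\<integral>x. vcoord \<beta> j x \<partial>Q t (m, s)) = ((s / (\<beta> + s)) * exp (- \<beta> * t / 2)) ^ j"
proof -
  let ?f = "vcoord \<beta> j :: (nat ^ 'n) \<times> real \<Rightarrow> real"
  let ?u = "\<lambda>t. \<integral>x. ?f x \<partial>Q t (m, s)"
  have Af: "dual_gen \<beta> ?f x = - (real j * \<beta> / 2) * ?f x" if "x \<in> space dual_space" for x
    using that dual_gen_vcoord[OF \<beta>] by (cases x) (auto simp: space_dual_space)
  have Af_meas: "dual_gen \<beta> ?f \<in> borel_measurable dual_space"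
    by (rule iffD2[OF measurable_cong[OF Af]], assumption)
      (intro borel_measurable_times borel_measurable_const vcoord_measurable)
  have bound: "\<forall>x\<in>space dual_space. \<bar>?f x\<bar> \<le> 1"
    using vcoord_bounds[OF \<beta>] by (auto simp: space_dual_space)
  note D = semigroup_derivative[OF Q gen vcoord_in_domain[OF \<beta>] vcoord_measurable bound Af_meas start_in_space]
  have int_Af: "(\<integral>x. dual_gen \<beta> ?f x \<partial>Q t (m, s)) = - (real j * \<beta> / 2) * ?u t" if "t \<ge> 0" for t
  proof -
    have "(\<integral>x. dual_gen \<beta> ?f x \<partial>Q t (m, s)) = (\<integral>x. - (real j * \<beta> / 2) * ?f x \<partial>Q t (m, s))"
      using QD(3)[OF that] by (intro Bochner_Integration.integral_cong refl Af) simp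
    then show ?thesis by simp
  qed
  have right: "((\<lambda>h. (?u (t + h) - ?u t) / h) \<longlongrightarrow> - (real j * \<beta> / 2) * ?u t) (at_right 0)" if "t \<ge> 0" for t
    unfolding int_Af[OF that, symmetric] by (rule D(1)[OF that])
  have "(?u has_real_derivative - (real j * \<beta> / 2) * ?u t) (at t)" if "t > 0" for t
    by (rule DERIV_if_right_derivative_continuous[OF D(2) _ right that]) (intro continuous_intros D(2))
  then have "?u t = ?u 0 * exp (- (real j * \<beta> / 2) * t)"
    by (intro linear_ode_solution D(2) t)
  also have "?u 0 = ?f (m, s)"
    using Q start_in_space by (simp add: transition_function_def integral_return vcoord_measurable)
  also have "\<dots> * exp (- (real j * \<beta> / 2) * t) = ((s / (\<beta> + s)) * exp (- \<beta> * t / 2)) ^ j"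
  proof -
    have "exp (- (real j * \<beta> / 2) * t) = exp (- \<beta> * t / 2) ^ j"
      by (subst exp_of_nat_mult[symmetric]) (simp add: algebra_simps)
    then show ?thesis by (simp only: vcoord_def prod.case mult_1_left power_mult_distrib)
  qed
  finally show ?thesis .
qed

text \<open>Zero variance: the first two moments of \<open>S / (\<beta> + S)\<close> are those of a point mass.\<close>

lemma AE_snd_eq_sflow:
  assumes t: "t \<ge> 0"
  shows "AE x in Q t (m, s). snd x = sflow \<beta> s t"
proof -
  interpret prob_space "Q t (m, s)" by (rule QD[OF t])
  let ?V = "vcoord \<beta> 1 :: (nat ^ 'n) \<times> real \<Rightarrow> real"
  define v where "v = (s / (\<beta> + s)) * exp (- \<beta> * t / 2)"
  have int: "integrable (Q t (m, s)) (vcoord \<beta> j)" for j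
    using vcoord_bounds[OF \<beta>] QD(3)[OF t]
    by (intro integrable_const_bound[of _ 1] AE_I2) (auto simp: space_dual_space measurable_Q[OF t] vcoord_measurable)
  have eq: "(?V x - v)\<^sup>2 = vcoord \<beta> 2 x - 2 * v * ?V x + v\<^sup>2" for x
    by (simp add: vcoord_def power2_diff case_prod_unfold)
  have int2: "integrable (Q t (m, s)) (\<lambda>x. (?V x - v)\<^sup>2)"
    unfolding eq using int by auto
  have "(\<integral>x. (?V x - v)\<^sup>2 \<partial>Q t (m, s)) = v\<^sup>2 - 2 * v * v + v\<^sup>2"
  proof -
    have "(\<integral>x. ?V x \<partial>Q t (m, s)) = v" "(\<integral>x. vcoord \<beta> 2 x \<partial>Q t (m, s)) = v\<^sup>2"
      using vcoord_moment[OF t, of 1] vcoord_moment[OF t, of 2] by (simp_all only: v_def power_one_right)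
    then show ?thesis unfolding eq using int by (simp add: prob_space)
  qed
  also have "\<dots> = 0" by (simp add: power2_eq_square)
  finally have "AE x in Q t (m, s). (?V x - v)\<^sup>2 = 0"
    using int2 by (subst (asm) integral_nonneg_eq_0_iff_AE) auto
  then show ?thesis
  proof (rule AE_mp, intro AE_I2 impI)
    fix x assume "x \<in> space (Q t (m, s))" "(?V x - v)\<^sup>2 = 0"
    then have x: "snd x \<ge> 0" "snd x / (\<beta> + snd x) = sflow \<beta> s t / (\<beta> + sflow \<beta> s t)"
      unfolding sflow_linearized[OF \<beta> s t] v_def[symmetric] QD(3)[OF t]
      by (auto simp: space_dual_space vcoord_def case_prod_unfold)
    \<comment> \<open>The coordinate \<open>s / (\<beta> + s)\<close> is injective on the half line;
      cross multiplication recovers \<open>snd x\<close> from it.\<close>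
    with \<beta> sflow_nonneg[OF \<beta> s t] have "snd x * (\<beta> + sflow \<beta> s t) = sflow \<beta> s t * (\<beta> + snd x)"
      by (subst (asm) frac_eq_eq) auto
    then have "\<beta> * snd x = \<beta> * sflow \<beta> s t" by (simp add: algebra_simps)
    with \<beta> show "snd x = sflow \<beta> s t" by simp
  qed
qed

text \<open>Since \<open>S\<close> almost surely equals the value of the flow, a function of
  \<open>S\<close> factors out of the expectation and only the probability of \<open>k\<close>
  remains.\<close>

lemma integral_indicator_times:
  assumes t: "t \<ge> 0" and f: "f \<in> borel_measurable borel"
  shows "(\<integral>x. indicator {k} (fst x) * f (snd x) \<partial>Q t (m, s)) = f (sflow \<beta> s t) * law t k"
proof -
  interpret prob_space "Q t (m, s)" by (rule QD[OF t])
  have meas: "(\<lambda>x. f (snd x)) \<in> borel_measurable (Q t (m, s))"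
    using f t by measurable
  have ind: "(\<lambda>x. indicator {k} (fst x) :: real) \<in> borel_measurable (Q t (m, s))"
    using indicator_fst_measurable by (simp add: measurable_Q[OF t])
  have set: "{k} \<times> {0..} \<in> sets (Q t (m, s))"
    unfolding QD(2)[OF t] dual_space_def by (intro pair_measureI) (auto simp: sets_restrict_space_iff)
  have "(\<integral>x. indicator {k} (fst x) * f (snd x) \<partial>Q t (m, s)) =
      (\<integral>x. f (sflow \<beta> s t) * indicator {k} (fst x) \<partial>Q t (m, s))"
  proof (rule integral_cong_AE)
    show "AE x in Q t (m, s). indicator {k} (fst x) * f (snd x) = f (sflow \<beta> s t) * indicator {k} (fst x)"
      using AE_snd_eq_sflow[OF t] by eventually_elim simp
  qed (intro borel_measurable_times borel_measurable_const ind meas)+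
  also have "\<dots> = f (sflow \<beta> s t) * (\<integral>x. indicator {k} (fst x) \<partial>Q t (m, s))"
    by simp
  also have "(\<integral>x. indicator {k} (fst x) \<partial>Q t (m, s)) = (\<integral>x. indicator ({k} \<times> {0..}) x \<partial>Q t (m, s) :: real)"
    using QD(3)[OF t] by (intro Bochner_Integration.integral_cong refl) (auto simp: space_dual_space indicator_def)
  also have "\<dots> = law t k"
    using set by (simp add: law_def)
  finally show ?thesis .
qed

lemma law_nonneg: "law t k \<ge> 0"
  by (simp add: law_def)

lemma law_0: "law 0 k = indicator {m} k"
proof -
  have "{k} \<times> {0..} \<in> sets dual_space"
    unfolding dual_space_def by (intro pair_measureI) (auto simp: sets_restrict_space_iff)
  moreover have "Q 0 (m, s) = return dual_space (m, s)"
    using Q start_in_space by (simp add: transition_function_def)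
  ultimately show ?thesis using s by (auto simp: law_def measure_return indicator_def)
qed

lemma sum_law:
  assumes t: "t \<ge> 0" and F: "finite F"
  shows "(\<Sum>k\<in>F. law t k) = measure (Q t (m, s)) (F \<times> {0..})"
proof -
  interpret prob_space "Q t (m, s)" by (rule QD[OF t])
  have set: "{k} \<times> {0..} \<in> sets (Q t (m, s))" for k
    unfolding QD(2)[OF t] dual_space_def by (intro pair_measureI) (auto simp: sets_restrict_space_iff)
  have "measure (Q t (m, s)) (\<Union>k\<in>F. {k} \<times> {0..}) = (\<Sum>k\<in>F. law t k)"
    unfolding law_def using F set by (intro finite_measure_finite_Union) (auto simp: disjoint_family_on_def)
  moreover have "(\<Union>k\<in>F. {k} \<times> {0..}) = F \<times> {0::real..}" by auto
  ultimately show ?thesis by simp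
qed

lemma sum_law_le_1: "t \<ge> 0 \<Longrightarrow> finite F \<Longrightarrow> (\<Sum>k\<in>F. law t k) \<le> 1"
  using QD(1)[of t] by (simp add: sum_law prob_space.prob_le_1)

text \<open>The semigroup differentiates the expectation \<open>?u\<close> of
  \<open>dual_test\<close>, which is \<open>law\<close> times the deterministic factor
  \<open>\<beta> / (\<beta> + S)\<close>. On dividing by that factor, the derivative of
  \<open>\<beta> + S\<close> cancels the extra drift term of \<open>dual_gen_dual_test\<close>, and
  the forward equation alone is left.\<close>

lemma law_derivative:
  shows law_continuous: "continuous_on {0..} (\<lambda>t. law t k)"
    and law_has_derivative: "t > 0 \<Longrightarrow> ((\<lambda>t. law t k) has_real_derivative
      (\<beta> + sflow \<beta> s t) / 2 * (\<Sum>i\<in>UNIV. real (k $ i + 1) * law t (k + axis i 1) - real (k $ i) * law t k)) (at t)"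
proof -
  let ?S = "sflow \<beta> s"
  let ?u = "\<lambda>k t. \<integral>x. dual_test \<beta> k x \<partial>Q t (m, s)"
  let ?D = "\<lambda>k t. \<Sum>i\<in>UNIV. real (k $ i + 1) * law t (k + axis i 1) - real (k $ i) * law t k"
  have S: "?S t \<ge> 0" if "t \<ge> 0" for t using sflow_nonneg[OF \<beta> s that] .
  have pos: "\<beta> + ?S t > 0" if "t \<ge> 0" for t using S[OF that] \<beta> by simp
  define J :: "nat ^ 'n \<Rightarrow> (nat ^ 'n) \<times> real \<Rightarrow> real" where "J k x = indicator {k} (fst x) * 1" for k x
  define K :: "nat ^ 'n \<Rightarrow> (nat ^ 'n) \<times> real \<Rightarrow> real"
    where "K k x = indicator {k} (fst x) * (snd x / (\<beta> + snd x))" for k x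
  have J_meas: "J k \<in> borel_measurable dual_space" for k
    unfolding J_def by (intro borel_measurable_times borel_measurable_const indicator_fst_measurable)
  have K_meas: "K k \<in> borel_measurable dual_space" for k
    unfolding K_def
    by (intro borel_measurable_times borel_measurable_divide borel_measurable_add
      borel_measurable_const dual_space_snd_measurable indicator_fst_measurable)
  have Af: "dual_gen \<beta> (dual_test \<beta> k) x =
      \<beta> / 2 * (\<Sum>i\<in>UNIV. real (k $ i + 1) * J (k + axis i 1) x - real (k $ i) * J k x) + \<beta> / 2 * K k x"
    if "x \<in> space dual_space" for x k
    using that dual_gen_dual_test[OF \<beta>, of "snd x" k "fst x"]
    by (auto simp: space_dual_space J_def K_def)
  have Af_meas: "dual_gen \<beta> (dual_test \<beta> k) \<in> borel_measurable dual_space" for k :: "nat ^ 'n"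
    by (rule iffD2[OF measurable_cong[OF Af[of _ k]]], assumption) (intro borel_measurable_add borel_measurable_times
        borel_measurable_const borel_measurable_sum borel_measurable_diff J_meas K_meas)
  have bound: "\<forall>x\<in>space dual_space. \<bar>dual_test \<beta> k x\<bar> \<le> 1" for k :: "nat ^ 'n"
    using dual_test_bounds[OF \<beta>] by (auto simp: space_dual_space)
  note D = semigroup_derivative[OF Q gen dual_test_in_domain[OF \<beta>] dual_test_measurable bound Af_meas start_in_space]
  have u: "?u k t = \<beta> / (\<beta> + ?S t) * law t k" if "t \<ge> 0" for k t
    using integral_indicator_times[OF that, of "\<lambda>r. \<beta> / (\<beta> + r)" k]
    by (simp add: dual_test_def case_prod_unfold)
  have law_eq: "law t k = ?u k t * (\<beta> + ?S t) / \<beta>" if "t \<ge> 0" for k t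
    using u[OF that] pos[OF that] \<beta> by simp
  have law_cont: "continuous_on {0..} (\<lambda>t. law t k)" for k
  proof -
    have "continuous_on {0..} (\<lambda>t. ?u k t * (\<beta> + ?S t) / \<beta>)"
      using \<beta> by (intro continuous_intros D(2) sflow_continuous s) auto
    then show ?thesis by (subst continuous_on_cong[OF refl law_eq]) auto
  qed
  then show "continuous_on {0..} (\<lambda>t. law t k)" .
  have int_Af: "(\<integral>x. dual_gen \<beta> (dual_test \<beta> k) x \<partial>Q t (m, s)) =
      \<beta> / 2 * ?D k t + \<beta> / 2 * (?S t / (\<beta> + ?S t) * law t k)" if t: "t \<ge> 0" for t k
  proof -
    interpret prob_space "Q t (m, s)" by (rule QD[OF t])
    have i1: "integrable (Q t (m, s)) (J k)" for k
      using J_meas by (intro integrable_const_bound[of _ 1] AE_I2) (auto simp: measurable_Q[OF t] J_def indicator_def)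
    have i2: "integrable (Q t (m, s)) (K k)"
    proof (rule integrable_const_bound[of _ 1])
      show "AE x in Q t (m, s). norm (K k x) \<le> 1"
        using \<beta> by (intro AE_I2) (auto simp: QD(3)[OF t] space_dual_space K_def indicator_def)
    qed (simp add: measurable_Q[OF t] K_meas)
    have "(\<integral>x. dual_gen \<beta> (dual_test \<beta> k) x \<partial>Q t (m, s)) =
      (\<integral>x. \<beta> / 2 * (\<Sum>i\<in>UNIV. real (k $ i + 1) * J (k + axis i 1) x - real (k $ i) * J k x) + \<beta> / 2 * K k x \<partial>Q t (m, s))"
      using QD(3)[OF t] by (intro Bochner_Integration.integral_cong refl Af) simp
    also have "\<dots> = \<beta> / 2 * (\<Sum>i\<in>UNIV. real (k $ i + 1) * (\<integral>x. J (k + axis i 1) x \<partial>Q t (m, s))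
        - real (k $ i) * (\<integral>x. J k x \<partial>Q t (m, s))) + \<beta> / 2 * (\<integral>x. K k x \<partial>Q t (m, s))"
      using i1 i2 by simp
    also have "\<dots> = \<beta> / 2 * ?D k t + \<beta> / 2 * (?S t / (\<beta> + ?S t) * law t k)"
    proof -
      have "(\<integral>x. J k x \<partial>Q t (m, s)) = law t k" for k
        unfolding J_def by (subst integral_indicator_times[OF t]) simp_all
      moreover have "(\<integral>x. K k x \<partial>Q t (m, s)) = ?S t / (\<beta> + ?S t) * law t k"
        unfolding K_def by (subst integral_indicator_times[OF t, of "\<lambda>r. r / (\<beta> + r)"]) simp_all
      ultimately show ?thesis by simp
    qed
    finally show ?thesis .
  qed
  have int_cont: "continuous_on {0..} (\<lambda>t. \<beta> / 2 * ?D k t + \<beta> / 2 * (?S t / (\<beta> + ?S t) * law t k))"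
    by (intro continuous_intros law_cont sflow_continuous[OF \<beta>] s) (use pos in \<open>force simp: less_imp_neq\<close>)
  assume t: "t > 0"
  have right: "((\<lambda>h. (?u k (t + h) - ?u k t) / h) \<longlongrightarrow>
      \<beta> / 2 * ?D k t + \<beta> / 2 * (?S t / (\<beta> + ?S t) * law t k)) (at_right 0)" if "t \<ge> 0" for t
    unfolding int_Af[OF that, symmetric] by (rule D(1)[OF that])
  have u': "(?u k has_real_derivative \<beta> / 2 * ?D k t + \<beta> / 2 * (?S t / (\<beta> + ?S t) * law t k)) (at t)"
    by (rule DERIV_if_right_derivative_continuous[OF D(2) int_cont right t])
  have S': "((\<lambda>t. \<beta> + ?S t) has_real_derivative - 1/2 * ?S t * (\<beta> + ?S t)) (at t)"
    using DERIV_add[OF DERIV_const sflow_has_derivative[OF \<beta> s less_imp_le[OF t]], of \<beta>] by simp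
  have e: "((\<beta> / 2 * d + \<beta> / 2 * (S' / b * l)) * b + - 1/2 * S' * b * (\<beta> / b * l)) / \<beta> = b / 2 * d"
    if "b > 0" for d S' b l :: real
  proof -
    have "(\<beta> / 2 * d + \<beta> / 2 * (S' / b * l)) * b = \<beta> * (b / 2 * d) + \<beta> / 2 * S' * l"
      using that by (simp add: field_simps)
    moreover have "- 1/2 * S' * b * (\<beta> / b * l) = - (\<beta> / 2 * S' * l)"
      using that by simp
    ultimately show ?thesis using \<beta> by simp
  qed
  have val: "((\<beta> / 2 * ?D k t + \<beta> / 2 * (?S t / (\<beta> + ?S t) * law t k)) * (\<beta> + ?S t)
      + - 1/2 * ?S t * (\<beta> + ?S t) * ?u k t) / \<beta> = (\<beta> + ?S t) / 2 * ?D k t"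
    unfolding u[OF less_imp_le[OF t]] by (rule e[OF pos[OF less_imp_le[OF t]]])
  have "((\<lambda>t. ?u k t * (\<beta> + ?S t) / \<beta>) has_real_derivative (\<beta> + ?S t) / 2 * ?D k t) (at t)"
    using DERIV_cdivide[OF DERIV_mult[OF u' S'], of \<beta>] unfolding val .
  then show "((\<lambda>t. law t k) has_real_derivative (\<beta> + ?S t) / 2 * ?D k t) (at t)"
    by (rule has_field_derivative_transform_within_open[OF _ open_greaterThan, of _ _ _ 0])
      (use t law_eq in auto)
qed

end

section \<open>Sums over the multi-indices below a given one\<close>

text \<open>These are the states that deaths can reach from \<open>m\<close>. Being finite, the set
  reduces every expectation over the dual process to a finite sum.\<close>

definition below :: "nat ^ 'n \<Rightarrow> (nat ^ 'n) set" where
  "below m = {k. \<forall>i. k $ i \<le> m $ i}"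

lemma finite_below [simp]: "finite (below m)"
proof -
  have "below m \<subseteq> vec_lambda ` (\<Pi>\<^sub>E i\<in>UNIV. {..m $ i})"
  proof
    fix k assume "k \<in> below m"
    then show "k \<in> vec_lambda ` (\<Pi>\<^sub>E i\<in>UNIV. {..m $ i})"
      by (intro image_eqI[of _ _ "vec_nth k"]) (auto simp: below_def PiE_def)
  qed
  then show ?thesis by (rule finite_subset) (intro finite_imageI finite_PiE; simp)
qed

lemma self_in_below [simp]: "m \<in> below m"
  by (simp add: below_def)

lemma below_diff_axis: "k \<in> below m \<Longrightarrow> k - axis i 1 \<in> below m"
  unfolding below_def by (auto intro: order.trans[OF diff_le_self])

text \<open>This is summation by parts for the death operator: reindex by
  \<open>k - axis i 1\<close>. States with \<open>k $ i = 0\<close> are not hit by the reindexing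
  but carry weight 0, and the second sum collects the inflow from outside
  \<open>below m\<close>.\<close>

lemma sum_below_shift:
  fixes a F :: "nat ^ 'n \<Rightarrow> real"
  shows "(\<Sum>k\<in>below m. real (k $ i + 1) * a (k + axis i 1) * F k) =
    (\<Sum>k\<in>below m. real (k $ i) * a k * F (k - axis i 1)) +
    (\<Sum>k | k \<in> below m \<and> k + axis i 1 \<notin> below m. real (k $ i + 1) * a (k + axis i 1) * F k)"
proof -
  let ?g = "\<lambda>k. real (k $ i + 1) * a (k + axis i 1) * F k"
  have "(\<Sum>k\<in>below m. ?g k) = (\<Sum>k | k \<in> below m \<and> k + axis i 1 \<in> below m. ?g k)
      + (\<Sum>k | k \<in> below m \<and> k + axis i 1 \<notin> below m. ?g k)"
    by (subst sum.union_disjoint[symmetric]) (auto intro!: sum.cong)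
  also have "(\<Sum>k | k \<in> below m \<and> k + axis i 1 \<in> below m. ?g k) =
      (\<Sum>k | k \<in> below m \<and> k $ i > 0. real (k $ i) * a k * F (k - axis i 1))"
  proof (rule sum.reindex_bij_witness[of _ "\<lambda>k. k - axis i 1" "\<lambda>k. k + axis i 1"])
    fix k assume k: "k \<in> {k. k \<in> below m \<and> k $ i > 0}"
    then show "(k - axis i 1) + axis i 1 = k"
      using nat_vec_diff_axis_eq_iff[of k i "k - axis i 1"] by auto
    with k show "k - axis i 1 \<in> {k. k \<in> below m \<and> k + axis i 1 \<in> below m}"
      using below_diff_axis[of k m i] by simp
  qed (auto simp: vec_eq_iff axis_def)
  also have "\<dots> = (\<Sum>k\<in>below m. real (k $ i) * a k * F (k - axis i 1))"
    by (rule sum.mono_neutral_left) auto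
  finally show ?thesis .
qed

section \<open>Conservation of mass: the dual process stays below its starting index\<close>

context dual_transition
begin

text \<open>Inside \<open>below m\<close> gains and losses cancel, so the mass there changes only by
  inflow from outside, which is nonnegative. It starts at 1 and, being a probability, cannot exceed
  1.\<close>

lemma law_sum_below:
  assumes t: "t \<ge> 0"
  shows "(\<Sum>k\<in>below m. law t k) = 1"
proof -
  let ?c = "\<lambda>t. (\<beta> + sflow \<beta> s t) / 2"
  have "(\<Sum>k\<in>below m. law 0 k) \<le> (\<Sum>k\<in>below m. law t k)"
  proof (cases "t = 0")
    case False
    show ?thesis
    proof (rule DERIV_nonneg_imp_increasing_open[OF t])
      fix r assume r: "0 < r" "r < t"
      have "((\<lambda>t. \<Sum>k\<in>below m. law t k) has_real_derivative
          (\<Sum>k\<in>below m. ?c r * (\<Sum>i\<in>UNIV. real (k $ i + 1) * law r (k + axis i 1) - real (k $ i) * law r k))) (at r)"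
        by (intro DERIV_sum law_has_derivative r)
      also have "(\<Sum>k\<in>below m. ?c r * (\<Sum>i\<in>UNIV. real (k $ i + 1) * law r (k + axis i 1) - real (k $ i) * law r k))
        = ?c r * (\<Sum>i\<in>UNIV. (\<Sum>k\<in>below m. real (k $ i + 1) * law r (k + axis i 1) * 1) - (\<Sum>k\<in>below m. real (k $ i) * law r k * 1))"
        unfolding sum_distrib_left[symmetric] sum_subtractf[symmetric] mult_1_right
        by (subst sum.swap) (rule refl)
      also have "\<dots> = ?c r * (\<Sum>i\<in>UNIV. \<Sum>k | k \<in> below m \<and> k + axis i 1 \<notin> below m. real (k $ i + 1) * law r (k + axis i 1))"
        unfolding sum_below_shift[where F = "\<lambda>_. 1"] by simp
      finally show "\<exists>y. ((\<lambda>t. \<Sum>k\<in>below m. law t k) has_real_derivative y) (at r) \<and> 0 \<le> y"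
        using \<beta> sflow_nonneg[OF \<beta> s, of r] r
        by (intro exI conjI) (assumption, intro mult_nonneg_nonneg sum_nonneg law_nonneg, auto)
    next
      show "continuous_on {0..t} (\<lambda>t. \<Sum>k\<in>below m. law t k)"
        by (intro continuous_intros continuous_on_subset[OF law_continuous]) auto
    qed
  qed simp
  moreover have "(\<Sum>k\<in>below m. law 0 k) = 1"
    by (simp add: law_0 indicator_def sum.delta if_distrib cong: if_cong)
  ultimately show ?thesis using sum_law_le_1[OF t, of "below m"] by simp
qed

lemma AE_fst_in_below:
  assumes t: "t \<ge> 0"
  shows "AE x in Q t (m, s). fst x \<in> below m"
proof -
  interpret prob_space "Q t (m, s)" by (rule QD[OF t])
  have "prob (below m \<times> {0..}) = 1"
    using law_sum_below[OF t] by (simp add: sum_law[OF t])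
  then have "AE x in Q t (m, s). x \<in> below m \<times> {0..}"
    by (rule AE_prob_1)
  then show ?thesis by eventually_elim auto
qed

lemma law_outside_below:
  assumes t: "t \<ge> 0" and k: "k \<notin> below m"
  shows "law t k = 0"
proof -
  have "(\<Sum>k\<in>insert k (below m). law t k) \<le> 1" by (rule sum_law_le_1[OF t]) simp
  then show ?thesis using k law_sum_below[OF t] law_nonneg[of t k] by simp
qed

text \<open>Almost surely the first component takes finitely many values and the second a single
  one, so the integrand agrees with a simple function. Hence no bound on \<open>F\<close> is
  required.\<close>

lemma dual_expectation:
  assumes t: "t \<ge> 0" and F: "\<And>k. F k \<in> borel_measurable borel"
  shows "integrable (Q t (m, s)) (\<lambda>x. F (fst x) (snd x))"
    and "(\<integral>x. F (fst x) (snd x) \<partial>Q t (m, s)) = (\<Sum>k\<in>below m. law t k * F k (sflow \<beta> s t))"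
proof -
  interpret prob_space "Q t (m, s)" by (rule QD[OF t])
  let ?c = "\<lambda>k. F k (sflow \<beta> s t)"
  let ?g = "\<lambda>x. \<Sum>k\<in>below m. indicator {k} (fst x) * ?c k"
  have ind: "(\<lambda>x. indicator {k} (fst x) :: real) \<in> borel_measurable (Q t (m, s))" for k
    using indicator_fst_measurable by (simp add: measurable_Q[OF t])
  have meas: "(\<lambda>x. F (fst x) (snd x)) \<in> borel_measurable (Q t (m, s))"
  proof -
    have "(\<lambda>x. F (fst x) (snd x)) \<in> borel_measurable dual_space"
      unfolding dual_space_def
      by (rule measurable_pair_measure_countable1)
        (use F in \<open>auto intro: measurable_restrict_space1\<close>)
    then show ?thesis by (simp add: measurable_Q[OF t])
  qed
  have eq: "AE x in Q t (m, s). ?g x = F (fst x) (snd x)"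
    using AE_snd_eq_sflow[OF t] AE_fst_in_below[OF t]
  proof eventually_elim
    case (elim x)
    have "?g x = (\<Sum>k\<in>below m. if fst x = k then ?c k else 0)"
      by (intro sum.cong) auto
    with elim show ?case by simp
  qed
  have i1: "integrable (Q t (m, s)) (\<lambda>x. indicator {k} (fst x) * ?c k)" for k
    by (intro integrable_mult_left integrable_const_bound[of _ 1] ind AE_I2) (auto simp: indicator_def)
  then have "integrable (Q t (m, s)) ?g" by (intro Bochner_Integration.integrable_sum)
  then show "integrable (Q t (m, s)) (\<lambda>x. F (fst x) (snd x))"
    by (rule integrable_cong_AE_imp[OF _ meas]) (use eq in assumption)
  have "(\<integral>x. F (fst x) (snd x) \<partial>Q t (m, s)) = (\<integral>x. ?g x \<partial>Q t (m, s))"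
  proof (rule integral_cong_AE)
    show "AE x in Q t (m, s). F (fst x) (snd x) = ?g x"
      using eq by eventually_elim (rule sym)
  qed (intro meas borel_measurable_sum borel_measurable_times ind borel_measurable_const)+
  also have "\<dots> = (\<Sum>k\<in>below m. \<integral>x. indicator {k} (fst x) * ?c k \<partial>Q t (m, s))"
    by (rule Bochner_Integration.integral_sum[OF i1])
  also have "\<dots> = (\<Sum>k\<in>below m. law t k * ?c k)"
    by (subst integral_indicator_times[OF t]) (auto simp: mult.commute)
  finally show "(\<integral>x. F (fst x) (snd x) \<partial>Q t (m, s)) = (\<Sum>k\<in>below m. law t k * ?c k)" .
qed

end

section \<open>Test functions for the Cox--Ingersoll--Ross process\<close>

definition expmono :: "nat \<Rightarrow> real \<Rightarrow> real \<Rightarrow> real" where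
  "expmono j \<mu> z = z ^ j * exp (- \<mu> * z)"

lemma expmono_nonneg: "z \<ge> 0 \<Longrightarrow> expmono j \<mu> z \<ge> 0"
  by (simp add: expmono_def)

lemma expmono_antimono: "z \<ge> 0 \<Longrightarrow> \<mu> \<le> \<nu> \<Longrightarrow> expmono j \<nu> z \<le> expmono j \<mu> z"
  unfolding expmono_def by (intro mult_left_mono) (auto intro: mult_right_mono)

text \<open>The single term \<open>(\<mu> * z) ^ j / fact j\<close> of the exponential series is at
  most the whole series \<open>exp (\<mu> * z)\<close>.\<close>

lemma expmono_le:
  assumes "\<mu> > 0" "z \<ge> 0"
  shows "expmono j \<mu> z \<le> fact j / \<mu> ^ j"
proof -
  have "(\<Sum>n\<in>{j}. (\<mu> * z) ^ n /\<^sub>R fact n) \<le> exp (\<mu> * z)"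
    unfolding exp_def using assms by (intro sum_le_suminf summable_exp_generic) auto
  then have "(\<mu> * z) ^ j \<le> fact j * exp (\<mu> * z)"
    by (simp add: divide_simps mult.commute)
  then show ?thesis
    using assms by (simp add: expmono_def exp_minus field_simps)
qed

lemma expmono_tendsto_0:
  assumes "\<mu> > 0"
  shows "(expmono j \<mu> \<longlongrightarrow> 0) at_top"
proof -
  have "LIM z at_top. \<mu> * z :> at_top"
    using assms by (intro filterlim_tendsto_pos_mult_at_top[OF tendsto_const]) (auto simp: filterlim_ident)
  from filterlim_compose[OF tendsto_power_div_exp_0[of j] this]
  have "((\<lambda>z. (\<mu> * z) ^ j / exp (\<mu> * z) / \<mu> ^ j) \<longlongrightarrow> 0 / \<mu> ^ j) at_top"
    using assms by (intro tendsto_divide tendsto_const) auto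
  moreover have "(\<mu> * z) ^ j / exp (\<mu> * z) / \<mu> ^ j = expmono j \<mu> z" for z
    using assms by (simp add: expmono_def exp_minus power_mult_distrib field_simps)
  ultimately show ?thesis by simp
qed

lemma expmono_continuous [continuous_intros]:
  "continuous_on A f \<Longrightarrow> continuous_on A g \<Longrightarrow> continuous_on A (\<lambda>x. expmono j (f x) (g x))"
  unfolding expmono_def by (intro continuous_intros)

lemma expmono_measurable [measurable]: "expmono j \<mu> \<in> borel_measurable borel"
  by (intro borel_measurable_continuous_onI continuous_intros)

lemma expmono_has_derivative:
  "(expmono j \<mu> has_real_derivative real j * expmono (j - 1) \<mu> z - \<mu> * expmono j \<mu> z) (at z within A)"
  unfolding expmono_def[abs_def] by (auto intro!: derivative_eq_intros simp: algebra_simps)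

lemma expmono_has_derivative_rate:
  "((\<lambda>\<mu>. expmono j \<mu> z) has_real_derivative - expmono (Suc j) \<mu> z) (at \<mu> within A)"
  unfolding expmono_def[abs_def] by (auto intro!: derivative_eq_intros simp: algebra_simps)

lemma expmono_C2:
  shows "expmono j \<mu> \<in> C2_half_line"
    and hderiv_expmono: "z \<ge> 0 \<Longrightarrow> hderiv (expmono j \<mu>) z = real j * expmono (j - 1) \<mu> z - \<mu> * expmono j \<mu> z"
    and hderiv2_expmono: "z \<ge> 0 \<Longrightarrow> hderiv (hderiv (expmono j \<mu>)) z =
      real j * (real (j - 1) * expmono (j - 1 - 1) \<mu> z - \<mu> * expmono (j - 1) \<mu> z)
      - \<mu> * (real j * expmono (j - 1) \<mu> z - \<mu> * expmono j \<mu> z)"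
proof -
  have 2: "((\<lambda>z. real j * expmono (j - 1) \<mu> z - \<mu> * expmono j \<mu> z) has_real_derivative
      real j * (real (j - 1) * expmono (j - 1 - 1) \<mu> z - \<mu> * expmono (j - 1) \<mu> z)
      - \<mu> * (real j * expmono (j - 1) \<mu> z - \<mu> * expmono j \<mu> z)) (at z within {0..})" for z
    by (intro DERIV_diff DERIV_cmult expmono_has_derivative)
  note C2 = C2_half_lineI[OF expmono_has_derivative 2]
  show "expmono j \<mu> \<in> C2_half_line"
    by (rule C2(1)) (intro continuous_intros)
  show "z \<ge> 0 \<Longrightarrow> hderiv (expmono j \<mu>) z = real j * expmono (j - 1) \<mu> z - \<mu> * expmono j \<mu> z"
    by (intro hderiv_eqI expmono_has_derivative)
  show "z \<ge> 0 \<Longrightarrow> hderiv (hderiv (expmono j \<mu>)) z =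
      real j * (real (j - 1) * expmono (j - 1 - 1) \<mu> z - \<mu> * expmono (j - 1) \<mu> z)
      - \<mu> * (real j * expmono (j - 1) \<mu> z - \<mu> * expmono j \<mu> z)"
    by (rule C2(2)) (intro continuous_intros)
qed

text \<open>The family is closed under the generator. Truncation in \<open>j - 1\<close> is harmless
  because its coefficient contains the factor \<open>j\<close>; the term of order
  \<open>j + 1\<close> is the one that the moving rate has to absorb.\<close>

lemma cir_gen_expmono:
  assumes "z \<ge> 0"
  shows "cir_gen a \<beta> (expmono j \<mu>) z = 1/2 * (real j * (a + real j - 1) * expmono (j - 1) \<mu> z
    - (a * \<mu> + \<beta> * real j + 2 * \<mu> * real j) * expmono j \<mu> z + \<mu> * (\<beta> + \<mu>) * expmono (j + 1) \<mu> z)"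
proof -
  have "(a - \<beta> * z) * (real j * expmono (j - 1) \<mu> z - \<mu> * expmono j \<mu> z)
      + z * (real j * (real (j - 1) * expmono (j - 1 - 1) \<mu> z - \<mu> * expmono (j - 1) \<mu> z)
        - \<mu> * (real j * expmono (j - 1) \<mu> z - \<mu> * expmono j \<mu> z)) =
    real j * (a + real j - 1) * expmono (j - 1) \<mu> z
      - (a * \<mu> + \<beta> * real j + 2 * \<mu> * real j) * expmono j \<mu> z + \<mu> * (\<beta> + \<mu>) * expmono (j + 1) \<mu> z"
  \<comment> \<open>The exponents \<open>j - 1\<close> and \<open>j - 1 - 1\<close> are truncated,
    so 0 and 1 have to be separated from the generic case.\<close>
  proof (cases j)
    case 0
    then show ?thesis by (simp add: expmono_def algebra_simps)
  next
    case (Suc n)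
    then show ?thesis by (cases n) (simp_all add: expmono_def algebra_simps)
  qed
  then show ?thesis
    unfolding cir_gen_def hderiv_expmono[OF assms] hderiv2_expmono[OF assms] by simp
qed

lemma expmono_in_cir_domain:
  assumes "\<mu> > 0"
  shows "expmono j \<mu> \<in> cir_domain a \<beta>"
proof -
  let ?g = "\<lambda>z. 1/2 * (real j * (a + real j - 1) * expmono (j - 1) \<mu> z
    - (a * \<mu> + \<beta> * real j + 2 * \<mu> * real j) * expmono j \<mu> z + \<mu> * (\<beta> + \<mu>) * expmono (j + 1) \<mu> z)"
  have "(?g \<longlongrightarrow> 1/2 * (real j * (a + real j - 1) * 0 - (a * \<mu> + \<beta> * real j + 2 * \<mu> * real j) * 0
      + \<mu> * (\<beta> + \<mu>) * 0)) at_top"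
    by (intro tendsto_intros expmono_tendsto_0 assms)
  moreover have "\<forall>\<^sub>F z in at_top. ?g z = cir_gen a \<beta> (expmono j \<mu>) z"
    using eventually_ge_at_top[of 0] by eventually_elim (simp only: cir_gen_expmono)
  ultimately have "(cir_gen a \<beta> (expmono j \<mu>) \<longlongrightarrow> 0) at_top"
    using tendsto_cong by fastforce
  then show ?thesis
    using expmono_C2 expmono_tendsto_0[OF assms] by (simp add: cir_domain_def)
qed

section \<open>Exponential moments of the Cox--Ingersoll--Ross process\<close>

lemma borel_measurable_half_line: "f \<in> borel_measurable borel \<Longrightarrow> f \<in> borel_measurable half_line"
  by (rule measurable_restrict_space1)

lemma space_half_line: "space half_line = {0..}"
  by (simp add: space_restrict_space)

locale half_line_prob =
  fixes N :: "real measure"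
  assumes prob: "prob_space N" and sets_N: "sets N = sets half_line"
begin

sublocale prob_space N by (rule prob)

lemma space_N: "space N = {0..}"
  using sets_eq_imp_space_eq[OF sets_N] by (simp add: space_half_line)

lemma measurable_N: "f \<in> borel_measurable borel \<Longrightarrow> f \<in> borel_measurable N"
  using borel_measurable_half_line measurable_cong_sets[OF sets_N refl] by blast

definition mom :: "nat \<Rightarrow> real \<Rightarrow> real" where
  "mom j \<mu> = (\<integral>y. expmono j \<mu> y \<partial>N)"

lemma expmono_integrable: "\<mu> > 0 \<Longrightarrow> integrable N (expmono j \<mu>)"
  by (rule integrable_const_bound[of _ "fact j / \<mu> ^ j"])
    (auto intro!: AE_I2 measurable_N expmono_le simp: space_N expmono_nonneg)

lemma mom_nonneg: "mom j \<mu> \<ge> 0"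
  unfolding mom_def by (intro integral_nonneg_AE AE_I2) (simp add: space_N expmono_nonneg)

lemma mom_le: "\<mu> \<ge> c \<Longrightarrow> c > 0 \<Longrightarrow> mom j \<mu> \<le> fact j / c ^ j"
  unfolding mom_def
proof (intro integral_le_const expmono_integrable AE_I2)
  fix y assume "\<mu> \<ge> c" "c > 0" "y \<in> space N"
  then show "expmono j \<mu> y \<le> fact j / c ^ j"
    using expmono_antimono[of y c \<mu> j] expmono_le[of c y j] by (simp add: space_N)
qed simp

lemma mom_has_derivative:
  assumes \<mu>: "\<mu> > 0"
  shows "(mom j has_real_derivative - mom (Suc j) \<mu>) (at \<mu>)"
proof -
  \<comment> \<open>All rates above \<open>c\<close> share the bound \<open>B\<close> on
    \<open>expmono (Suc j)\<close>. It makes \<open>expmono j\<close> Lipschitz in the rate and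
    dominates the difference quotients under the integral.\<close>
  define c where "c = \<mu> / 2"
  have c: "0 < c" "c < \<mu>" using \<mu> by (auto simp: c_def)
  define B :: real where "B = fact (Suc j) / c ^ Suc j"
  have lip: "\<bar>expmono j \<nu> y - expmono j \<mu> y\<bar> \<le> B * \<bar>\<nu> - \<mu>\<bar>" if "c \<le> \<nu>" "y \<ge> 0" for \<nu> y
  proof -
    have "norm (expmono j \<nu> y - expmono j \<mu> y) \<le> B * norm (\<nu> - \<mu>)"
    proof (rule field_differentiable_bound[OF _ expmono_has_derivative_rate])
      show "norm (- expmono (Suc j) w y) \<le> B" if "w \<in> {c..}" for w
        using that c \<open>y \<ge> 0\<close> expmono_nonneg[of y "Suc j" w]
          order.trans[OF expmono_antimono[of y c w "Suc j"] expmono_le[of c y "Suc j"]]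
        by (simp add: B_def)
    qed (use that c in auto)
    then show ?thesis by simp
  qed
  have "((\<lambda>\<nu>. (mom j \<nu> - mom j \<mu>) / (\<nu> - \<mu>)) \<longlongrightarrow> - mom (Suc j) \<mu>) (at \<mu> within {c<..})"
    unfolding tendsto_at_iff_sequentially comp_def
  proof safe
    fix X :: "nat \<Rightarrow> real" assume X: "\<forall>i. X i \<in> {c<..} - {\<mu>}" "X \<longlonglongrightarrow> \<mu>"
    have "(\<lambda>n. \<integral>y. (expmono j (X n) y - expmono j \<mu> y) / (X n - \<mu>) \<partial>N) \<longlonglongrightarrow> (\<integral>y. - expmono (Suc j) \<mu> y \<partial>N)"
    proof (rule integral_dominated_convergence[where w = "\<lambda>_. B"])
      show "AE y in N. (\<lambda>n. (expmono j (X n) y - expmono j \<mu> y) / (X n - \<mu>)) \<longlonglongrightarrow> - expmono (Suc j) \<mu> y"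
      proof (rule AE_I2)
        fix y
        have "((\<lambda>\<nu>. (expmono j \<nu> y - expmono j \<mu> y) / (\<nu> - \<mu>)) \<longlongrightarrow> - expmono (Suc j) \<mu> y) (at \<mu>)"
          using expmono_has_derivative_rate[of j y \<mu> UNIV] by (simp add: has_field_derivative_iff)
        then show "(\<lambda>n. (expmono j (X n) y - expmono j \<mu> y) / (X n - \<mu>)) \<longlonglongrightarrow> - expmono (Suc j) \<mu> y"
          using X unfolding tendsto_at_iff_sequentially comp_def by blast
      qed
      show "AE y in N. norm ((expmono j (X n) y - expmono j \<mu> y) / (X n - \<mu>)) \<le> B" for n
      proof (rule AE_I2)
        fix y assume "y \<in> space N"
        moreover have "c \<le> X n" "X n \<noteq> \<mu>" using X(1) by (auto intro: less_imp_le)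
        ultimately show "norm ((expmono j (X n) y - expmono j \<mu> y) / (X n - \<mu>)) \<le> B"
          using lip[of "X n" y] by (simp add: space_N divide_le_eq)
      qed
    qed (auto intro!: measurable_N)
    moreover have e1: "(\<integral>y. (expmono j (X n) y - expmono j \<mu> y) / (X n - \<mu>) \<partial>N) = (mom j (X n) - mom j \<mu>) / (X n - \<mu>)" for n
    proof -
      have "X n > 0" using X(1) c by (auto intro: less_trans)
      then show ?thesis using \<mu> by (simp add: mom_def expmono_integrable)
    qed
    moreover have e2: "(\<integral>y. - expmono (Suc j) \<mu> y \<partial>N) = - mom (Suc j) \<mu>" by (simp add: mom_def)
    ultimately show "(\<lambda>n. (mom j (X n) - mom j \<mu>) / (X n - \<mu>)) \<longlonglongrightarrow> - mom (Suc j) \<mu>"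
      by (simp only: e1 e2)
  qed
  then have "(mom j has_real_derivative - mom (Suc j) \<mu>) (at \<mu> within {c<..})"
    by (simp add: has_field_derivative_iff)
  then show ?thesis
    using c(2) by (subst (asm) at_within_open) auto
qed

text \<open>The constant does not depend on the measure \<open>N\<close>. With \<open>N\<close> the
  law at a variable time, the estimate is uniform in time.\<close>

lemma mom_lipschitz:
  assumes "c > 0" "\<mu> \<ge> c" "\<nu> \<ge> c"
  shows "\<bar>mom j \<mu> - mom j \<nu>\<bar> \<le> fact (Suc j) / c ^ Suc j * \<bar>\<mu> - \<nu>\<bar>"
proof -
  have "norm (mom j \<mu> - mom j \<nu>) \<le> fact (Suc j) / c ^ Suc j * norm (\<mu> - \<nu>)"
  proof (rule field_differentiable_bound[of "{c..}"])
    show "(mom j has_field_derivative - mom (Suc j) w) (at w within {c..})" if "w \<in> {c..}" for w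
      by (rule has_field_derivative_at_within[OF mom_has_derivative]) (use that assms(1) in simp)
    show "norm (- mom (Suc j) w) \<le> fact (Suc j) / c ^ Suc j" if "w \<in> {c..}" for w
      using that assms(1) mom_nonneg[of "Suc j" w] mom_le[of c w "Suc j"] by simp
  qed (use assms in auto)
  then show ?thesis by simp
qed

end

locale cir_transition =
  fixes a \<beta> :: real and P :: "real \<Rightarrow> real \<Rightarrow> real measure" and z :: real
  assumes a: "a > 0" and \<beta>: "\<beta> > 0" and z: "z \<ge> 0"
    and P: "transition_function half_line P"
    and gen: "has_generator half_line P (cir_domain a \<beta>) (cir_gen a \<beta>)"
begin

lemma start_in_half_line: "z \<in> space half_line"
  using z by (simp add: space_half_line)

lemma half_line_prob_P: "t \<ge> 0 \<Longrightarrow> half_line_prob (P t z)"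
  by (intro half_line_prob.intro transition_functionD[OF P _ start_in_half_line])

definition pmom :: "nat \<Rightarrow> real \<Rightarrow> real \<Rightarrow> real" where
  "pmom j \<mu> t = (\<integral>y. expmono j \<mu> y \<partial>P t z)"

lemma pmom_eq_mom: "t \<ge> 0 \<Longrightarrow> pmom j \<mu> t = half_line_prob.mom (P t z) j \<mu>"
  by (simp add: pmom_def half_line_prob.mom_def[OF half_line_prob_P])

definition pmom_rate :: "nat \<Rightarrow> real \<Rightarrow> real \<Rightarrow> real" where
  "pmom_rate j \<mu> t = 1/2 * (real j * (a + real j - 1) * pmom (j - 1) \<mu> t
    - (a * \<mu> + \<beta> * real j + 2 * \<mu> * real j) * pmom j \<mu> t + \<mu> * (\<beta> + \<mu>) * pmom (j + 1) \<mu> t)"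

lemma pmom_time_derivative:
  assumes \<mu>: "\<mu> > 0"
  shows pmom_continuous_time: "continuous_on {0..} (pmom j \<mu>)"
    and pmom_has_time_derivative: "t > 0 \<Longrightarrow> (pmom j \<mu> has_real_derivative pmom_rate j \<mu> t) (at t)"
proof -
  let ?g = "\<lambda>j y. 1/2 * (real j * (a + real j - 1) * expmono (j - 1) \<mu> y
    - (a * \<mu> + \<beta> * real j + 2 * \<mu> * real j) * expmono j \<mu> y + \<mu> * (\<beta> + \<mu>) * expmono (j + 1) \<mu> y)"
  have Af: "cir_gen a \<beta> (expmono j \<mu>) y = ?g j y" if "y \<in> space half_line" for y j
    using that by (intro cir_gen_expmono) (simp add: space_half_line)
  have Af_meas: "cir_gen a \<beta> (expmono j \<mu>) \<in> borel_measurable half_line" for j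
    by (rule iffD2[OF measurable_cong[OF Af[of _ j]]], assumption)
      (intro borel_measurable_half_line borel_measurable_times borel_measurable_add borel_measurable_diff
        borel_measurable_const expmono_measurable)
  have bound: "\<forall>y\<in>space half_line. \<bar>expmono j \<mu> y\<bar> \<le> fact j / \<mu> ^ j" for j
    using \<mu> by (auto simp: space_half_line expmono_nonneg expmono_le)
  have cont: "continuous_on {0..} (pmom j \<mu>)" for j
    unfolding pmom_def[abs_def] 
    by (rule semigroup_continuous[where A = "cir_gen a \<beta>" and f = "expmono j \<mu>", OF P gen expmono_in_cir_domain[OF \<mu>, of j]
      borel_measurable_half_line[OF expmono_measurable] bound[of j] Af_meas[of j] start_in_half_line])
  show "continuous_on {0..} (pmom j \<mu>)" by (rule cont)
  have int_Af: "(\<integral>y. cir_gen a \<beta> (expmono j \<mu>) y \<partial>P t z) = pmom_rate j \<mu> t" if t: "t \<ge> 0" for j t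
  proof -
    interpret N: half_line_prob "P t z" by (rule half_line_prob_P[OF t])
    have "(\<integral>y. cir_gen a \<beta> (expmono j \<mu>) y \<partial>P t z) = (\<integral>y. ?g j y \<partial>P t z)"
      by (intro Bochner_Integration.integral_cong refl cir_gen_expmono) (simp add: N.space_N)
    also have "\<dots> = pmom_rate j \<mu> t"
      using N.expmono_integrable[OF \<mu>] by (simp add: pmom_rate_def pmom_def)
    finally show ?thesis .
  qed
  have right: "((\<lambda>h. (pmom j \<mu> (t + h) - pmom j \<mu> t) / h) \<longlongrightarrow> pmom_rate j \<mu> t) (at_right 0)" if "t \<ge> 0" for j t
    unfolding int_Af[OF that, symmetric] pmom_def
    by (rule semigroup_right_derivative[where A = "cir_gen a \<beta>" and f = "expmono j \<mu>", OF P gen expmono_in_cir_domain[OF \<mu>, of j]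
      borel_measurable_half_line[OF expmono_measurable] bound[of j] Af_meas[of j] start_in_half_line that])
  have cont': "continuous_on {0..} (pmom_rate j \<mu>)"
    unfolding pmom_rate_def[abs_def] by (intro continuous_intros cont)
  assume t: "t > 0"
  show "(pmom j \<mu> has_real_derivative pmom_rate j \<mu> t) (at t)"
    by (rule DERIV_if_right_derivative_continuous[OF cont cont' right t])
qed

text \<open>Continuity in time at a fixed rate combines with the Lipschitz estimate in the rate,
  which is uniform in time.\<close>

lemma pmom_continuous: "continuous_on ({0..} \<times> {0<..}) (\<lambda>(t, \<mu>). pmom j \<mu> t)"
  unfolding continuous_on_def
proof (intro ballI)
  fix x0 :: "real \<times> real" assume "x0 \<in> {0..} \<times> {0<..}"
  then obtain t0 \<mu>0 where x0: "x0 = (t0, \<mu>0)" and t0: "t0 \<ge> 0" and \<mu>0: "\<mu>0 > 0" by auto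
  define c where "c = \<mu>0 / 2"
  have c: "0 < c" "c < \<mu>0" using \<mu>0 by (auto simp: c_def)
  let ?F = "at x0 within {0..} \<times> {0<..}"
  let ?B = "fact (Suc j) / c ^ Suc j :: real"
  have fst: "(fst \<longlongrightarrow> t0) ?F" and snd: "(snd \<longlongrightarrow> \<mu>0) ?F"
    unfolding x0 by (auto intro!: tendsto_eq_intros)
  have ev: "\<forall>\<^sub>F x in ?F. x \<in> {0..} \<times> {0<..}" by (auto simp: eventually_at_filter)
  have 1: "((\<lambda>x. pmom j \<mu>0 (fst x)) \<longlongrightarrow> pmom j \<mu>0 t0) ?F"
    by (rule continuous_on_tendsto_compose[OF pmom_continuous_time[OF \<mu>0] fst])
      (use t0 ev in \<open>auto elim: eventually_mono\<close>)
  have 2: "((\<lambda>x. ?B * \<bar>snd x - \<mu>0\<bar> + \<bar>pmom j \<mu>0 (fst x) - pmom j \<mu>0 t0\<bar>) \<longlongrightarrow> 0) ?F"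
  proof -
    have "((\<lambda>x. ?B * \<bar>snd x - \<mu>0\<bar> + \<bar>pmom j \<mu>0 (fst x) - pmom j \<mu>0 t0\<bar>) \<longlongrightarrow>
        ?B * \<bar>\<mu>0 - \<mu>0\<bar> + \<bar>pmom j \<mu>0 t0 - pmom j \<mu>0 t0\<bar>) ?F"
      by (intro tendsto_intros 1 snd)
    then show ?thesis by simp
  qed
  have "((\<lambda>x. pmom j (snd x) (fst x) - pmom j \<mu>0 t0) \<longlongrightarrow> 0) ?F"
  proof (rule Lim_null_comparison[OF _ 2])
    have "\<forall>\<^sub>F x in ?F. snd x > c" by (rule order_tendstoD(1)[OF snd c(2)])
    then show "\<forall>\<^sub>F x in ?F. norm (pmom j (snd x) (fst x) - pmom j \<mu>0 t0)
        \<le> ?B * \<bar>snd x - \<mu>0\<bar> + \<bar>pmom j \<mu>0 (fst x) - pmom j \<mu>0 t0\<bar>"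
      using ev
    proof eventually_elim
      case (elim x)
      then have "fst x \<ge> 0" by auto
      with elim c show ?case
        using half_line_prob.mom_lipschitz[OF half_line_prob_P, of "fst x" c "snd x" \<mu>0 j]
        by (simp add: pmom_eq_mom)
    qed
  qed
  then show "((\<lambda>(t, \<mu>). pmom j \<mu> t) \<longlongrightarrow> (case x0 of (t, \<mu>) \<Rightarrow> pmom j \<mu> t)) ?F"
    unfolding case_prod_unfold x0 fst_conv snd_conv by (rule Lim_null[THEN iffD2])
qed

text \<open>Total differentiability follows when both partial derivatives exist and one of them is
  jointly continuous. The partial derivative in the rate is again a \<open>pmom\<close>, so
  \<open>pmom_continuous\<close> applies; the chain rule along \<open>(r, l r)\<close> does the
  rest.\<close>

lemma pmom_path_has_derivative:
  assumes r: "r > 0" and l: "l r > 0" "(l has_real_derivative l') (at r)"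
  shows "((\<lambda>r. pmom j (l r) r) has_real_derivative pmom_rate j (l r) r - pmom (Suc j) (l r) r * l') (at r)"
proof -
  have "((\<lambda>(t, \<mu>). pmom j \<mu> t) has_derivative
      (\<lambda>(h, k). pmom_rate j (l r) r * h + blinfun_mult_right (- pmom (Suc j) (l r) r) k))
      (at (r, l r) within {0<..} \<times> {0<..})"
  proof (rule has_derivative_partialsI[where fy = "\<lambda>t \<mu>. blinfun_mult_right (- pmom (Suc j) \<mu> t)"])
    show "((\<lambda>x. pmom j (l r) x) has_derivative (*) (pmom_rate j (l r) r)) (at r within {0<..})"
      using has_field_derivative_at_within[OF pmom_has_time_derivative[OF l(1) r]]
      by (simp add: has_field_derivative_def)
    show "((\<lambda>\<mu>. pmom j \<mu> t) has_derivative blinfun_apply (blinfun_mult_right (- pmom (Suc j) \<mu> t)))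
        (at \<mu> within {0<..})" if "t \<in> {0<..}" "\<mu> \<in> {0<..}" for t \<mu>
    proof -
      have t: "t \<ge> 0" and \<mu>: "\<mu> > 0" using that by auto
      have eq: "(\<lambda>\<mu>. pmom j \<mu> t) = half_line_prob.mom (P t z) j"
        using t by (simp add: pmom_eq_mom fun_eq_iff)
      show ?thesis
        using has_field_derivative_at_within[OF half_line_prob.mom_has_derivative[OF half_line_prob_P[OF t] \<mu>]]
        unfolding eq blinfun_mult_right.rep_eq pmom_eq_mom[OF t] has_field_derivative_def .
    qed
    have "continuous_on ({0<..} \<times> {0<..}) (\<lambda>x. blinfun_mult_right (- (\<lambda>(t, \<mu>). pmom (Suc j) \<mu> t) x))"
      by (intro continuous_intros bounded_linear.continuous_on[OF bounded_linear_blinfun_mult_right]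
          continuous_on_subset[OF pmom_continuous]) auto
    then show "continuous (at (r, l r) within {0<..} \<times> {0<..}) (\<lambda>(t, \<mu>). blinfun_mult_right (- pmom (Suc j) \<mu> t))"
      using r l(1) by (simp add: continuous_on_eq_continuous_within case_prod_unfold)
  qed (use l in auto)
  moreover have "at (r, l r) within {0<..} \<times> {0<..} = at (r, l r)"
    using r l(1) by (intro at_within_open open_Times) auto
  ultimately have D: "((\<lambda>(t, \<mu>). pmom j \<mu> t) has_derivative
      (\<lambda>(h, k). pmom_rate j (l r) r * h + - pmom (Suc j) (l r) r * k)) (at (r, l r))"
    by simp
  have "((\<lambda>r. (r, l r)) has_derivative (\<lambda>h. (h, l' * h))) (at r)"
    using l(2) by (intro has_derivative_Pair has_derivative_ident) (simp add: has_field_derivative_def)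
  from has_derivative_compose[OF this D]
  have "((\<lambda>r. pmom j (l r) r) has_derivative
      (\<lambda>h. pmom_rate j (l r) r * h + - pmom (Suc j) (l r) r * (l' * h))) (at r)"
    by (simp only: prod.case)
  moreover have "(\<lambda>h. pmom_rate j (l r) r * h + - pmom (Suc j) (l r) r * (l' * h)) =
      (*) (pmom_rate j (l r) r - pmom (Suc j) (l r) r * l')"
    by (auto simp: fun_eq_iff algebra_simps)
  ultimately show ?thesis by (simp only: has_field_derivative_def)
qed

section \<open>The coefficient of the one-dimensional duality function\<close>

definition prefactor :: "nat \<Rightarrow> real \<Rightarrow> real" where
  "prefactor j \<mu> = Gamma a / Gamma (a + real j) * ((\<beta> + \<mu>) / \<beta>) powr a * (\<beta> + \<mu>) ^ j"

lemma hC_eq_expmono: "hC \<beta> a y j \<mu> = prefactor j \<mu> * expmono j \<mu> y"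
  by (simp add: hC_def prefactor_def expmono_def)

lemma prefactor_nonneg: "\<mu> \<ge> 0 \<Longrightarrow> prefactor j \<mu> \<ge> 0"
  unfolding prefactor_def using a \<beta>
  by (intro mult_nonneg_nonneg divide_nonneg_nonneg Gamma_real_nonneg zero_le_power powr_ge_zero) simp_all

lemma prefactor_mono:
  assumes "0 \<le> \<mu>" "\<mu> \<le> \<nu>"
  shows "prefactor j \<mu> \<le> prefactor j \<nu>"
proof -
  have "((\<beta> + \<mu>) / \<beta>) powr a \<le> ((\<beta> + \<nu>) / \<beta>) powr a"
    using assms a \<beta> by (intro powr_mono2 divide_right_mono) simp_all
  moreover have "(\<beta> + \<mu>) ^ j \<le> (\<beta> + \<nu>) ^ j"
    using assms \<beta> by (intro power_mono) simp_all
  moreover have "0 \<le> Gamma a / Gamma (a + real j)"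
    using a by (intro divide_nonneg_nonneg Gamma_real_nonneg) simp_all
  ultimately show ?thesis
    unfolding prefactor_def mult.assoc using assms \<beta>
    by (intro mult_left_mono mult_mono) simp_all
qed

text \<open>The recursion of the Gamma function explains the normalisation of \<open>hC\<close>: it
  converts the weight \<open>a + j\<close> produced by the generator into the factor
  \<open>\<beta> + \<mu>\<close> of the death rate.\<close>

lemma prefactor_Suc: "prefactor (Suc j) \<mu> * (a + real j) = prefactor j \<mu> * (\<beta> + \<mu>)"
proof -
  have "Gamma (a + real (Suc j)) = Gamma (a + real j + 1)" by (simp add: add_ac)
  also have "\<dots> = (a + real j) * Gamma (a + real j)"
    using a by (intro Gamma_plus1) (auto elim!: nonpos_Ints_cases)
  finally have "Gamma (a + real (Suc j)) = (a + real j) * Gamma (a + real j)" .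
  moreover have "a + real j \<noteq> 0" using a by simp
  ultimately show ?thesis unfolding prefactor_def by (simp del: of_nat_Suc)
qed

lemma prefactor_has_derivative:
  assumes "\<mu> \<ge> 0"
  shows "(prefactor j has_real_derivative prefactor j \<mu> * (a + real j) / (\<beta> + \<mu>)) (at \<mu>)"
proof -
  have pos: "(\<beta> + \<mu>) / \<beta> > 0" "\<beta> + \<mu> > 0" using assms \<beta> by auto
  have 1: "((\<lambda>\<mu>. ((\<beta> + \<mu>) / \<beta>) powr a) has_real_derivative ((\<beta> + \<mu>) / \<beta>) powr a * a / (\<beta> + \<mu>)) (at \<mu>)"
    using pos \<beta> by (auto intro!: derivative_eq_intros simp: powr_diff)
  have 2: "((\<lambda>\<mu>. (\<beta> + \<mu>) ^ j) has_real_derivative (\<beta> + \<mu>) ^ j * real j / (\<beta> + \<mu>)) (at \<mu>)"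
  proof (cases j)
    case (Suc n)
    have "((\<lambda>\<mu>. \<beta> + \<mu>) has_real_derivative 1) (at \<mu>)" by (auto intro!: derivative_eq_intros)
    from DERIV_power[OF this, of j] show ?thesis using pos by (simp add: Suc mult.commute)
  qed simp
  have "((\<lambda>\<mu>. (Gamma a / Gamma (a + real j)) * (((\<beta> + \<mu>) / \<beta>) powr a * (\<beta> + \<mu>) ^ j)) has_real_derivative
      (Gamma a / Gamma (a + real j)) * (((\<beta> + \<mu>) / \<beta>) powr a * a / (\<beta> + \<mu>) * (\<beta> + \<mu>) ^ j
        + (\<beta> + \<mu>) ^ j * real j / (\<beta> + \<mu>) * ((\<beta> + \<mu>) / \<beta>) powr a)) (at \<mu>)"
    by (intro DERIV_cmult DERIV_mult 1 2)
  then show ?thesis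
    unfolding prefactor_def[abs_def] by (simp add: algebra_simps add_divide_distrib)
qed

end

text \<open>The flow from 0 stays at 0; comparing with it bounds every other flow by its starting
  value.\<close>

lemma sflow_le:
  assumes "\<beta> > 0" "s \<ge> 0" "t \<ge> 0"
  shows "sflow \<beta> s t \<le> s"
  using sflow_diff(2)[OF assms(1) order_refl assms(3,2)] by (simp add: sflow_def)

section \<open>Expectations of the one-dimensional factors along the flow\<close>

context cir_transition
begin

text \<open>The flow runs for the remaining time \<open>T - r\<close>, so the rate increases back to
  \<open>s\<close> as \<open>r\<close> grows. The quantity interpolates between \<open>hC\<close> at
  the fixed point \<open>z\<close> with the flow run for \<open>T\<close>, at \<open>r = 0\<close>,
  and the expectation of \<open>hC\<close> with parameter \<open>s\<close>, at
  \<open>r = T\<close>.\<close>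

definition cirw :: "real \<Rightarrow> real \<Rightarrow> nat \<Rightarrow> real \<Rightarrow> real" where
  "cirw T s j r = (\<integral>y. hC \<beta> a y j (sflow \<beta> s (T - r)) \<partial>P r z)"

lemma cirw_eq: "cirw T s j r = prefactor j (sflow \<beta> s (T - r)) * pmom j (sflow \<beta> s (T - r)) r"
  unfolding cirw_def hC_eq_expmono pmom_def by simp

lemma cirw_0: "cirw T s j 0 = hC \<beta> a z j (sflow \<beta> s T)"
proof -
  have "pmom j \<mu> 0 = expmono j \<mu> z" for \<mu>
    using P start_in_half_line borel_measurable_half_line[OF expmono_measurable]
    unfolding transition_function_def pmom_def by (simp add: integral_return)
  then show ?thesis by (simp add: cirw_eq hC_eq_expmono)
qed

lemma cirw_nonneg:
  assumes "s \<ge> 0" "0 \<le> r" "r \<le> T"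
  shows "cirw T s j r \<ge> 0"
proof -
  interpret N: half_line_prob "P r z" by (rule half_line_prob_P[OF assms(2)])
  have "sflow \<beta> s (T - r) \<ge> 0" using assms by (intro sflow_nonneg \<beta>) auto
  then show ?thesis
    unfolding cirw_eq pmom_eq_mom[OF assms(2)]
    by (intro mult_nonneg_nonneg prefactor_nonneg N.mom_nonneg)
qed

lemma cirw_continuous:
  assumes s: "s > 0"
  shows "continuous_on {0..T} (cirw T s j)"
proof -
  have l: "continuous_on {0..T} (\<lambda>r. sflow \<beta> s (T - r))"
    using s by (intro continuous_on_compose2[OF sflow_continuous[OF \<beta>]] continuous_intros) auto
  have pre: "continuous_on {0..} (prefactor j)"
    using prefactor_has_derivative by (intro continuous_at_imp_continuous_on ballI DERIV_isCont) auto
  have c1: "continuous_on {0..T} (\<lambda>r. prefactor j (sflow \<beta> s (T - r)))"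
    using s by (intro continuous_on_compose2[OF pre l]) (auto intro: sflow_nonneg[OF \<beta>])
  have "continuous_on {0..T} (\<lambda>r. (\<lambda>(t, \<mu>). pmom j \<mu> t) (r, sflow \<beta> s (T - r)))"
    using s by (intro continuous_on_compose2[OF pmom_continuous continuous_on_Pair[OF continuous_on_id l]])
      (auto intro: sflow_pos[OF \<beta>])
  then have "continuous_on {0..T} (\<lambda>r. pmom j (sflow \<beta> s (T - r)) r)" by (simp only: prod.case)
  from continuous_on_mult[OF c1 this] show ?thesis unfolding cirw_eq[abs_def] .
qed

text \<open>The rate moves with speed \<open>\<mu> * (\<beta> + \<mu>) / 2\<close>, which removes
  the moment of order \<open>j + 1\<close>. The logarithmic derivative
  \<open>(a + j) / (\<beta> + \<mu>)\<close> of \<open>prefactor\<close> adds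
  \<open>\<mu> * (a + j) / 2\<close> to the diagonal coefficient and leaves
  \<open>- j * (\<beta> + \<mu>) / 2\<close>; by \<open>prefactor_Suc\<close> the moment of order
  \<open>j - 1\<close> gets the opposite coefficient.\<close>

lemma cirw_has_derivative:
  assumes s: "s > 0" and r: "0 < r" "r < T"
  shows "(cirw T s j has_real_derivative
    (\<beta> + sflow \<beta> s (T - r)) / 2 * real j * (cirw T s (j - 1) r - cirw T s j r)) (at r)"
proof -
  let ?l = "\<lambda>r. sflow \<beta> s (T - r)"
  define \<mu> where "\<mu> = ?l r"
  have \<mu>: "\<mu> > 0" using s r by (auto simp: \<mu>_def intro: sflow_pos[OF \<beta>])
  then have b\<mu>: "\<beta> + \<mu> > 0" using \<beta> by simp
  have "(sflow \<beta> s has_real_derivative - 1/2 * \<mu> * (\<beta> + \<mu>)) (at (T - r))"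
    using sflow_has_derivative[OF \<beta>, of s "T - r"] s r by (simp add: \<mu>_def)
  moreover have "((\<lambda>r. T - r) has_real_derivative - 1) (at r)"
    by (auto intro!: derivative_eq_intros)
  ultimately have "(?l has_real_derivative - 1/2 * \<mu> * (\<beta> + \<mu>) * - 1) (at r)"
    by (rule DERIV_chain2)
  then have l: "(?l has_real_derivative 1/2 * \<mu> * (\<beta> + \<mu>)) (at r)" by simp
  have "(prefactor j has_real_derivative prefactor j \<mu> * (a + real j) / (\<beta> + \<mu>)) (at (?l r))"
    using prefactor_has_derivative[of \<mu> j] \<mu> by (simp add: \<mu>_def)
  from DERIV_chain2[OF this l]
  have 1: "((\<lambda>r. prefactor j (?l r)) has_real_derivative
      prefactor j \<mu> * (a + real j) / (\<beta> + \<mu>) * (1/2 * \<mu> * (\<beta> + \<mu>))) (at r)" .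
  have 2: "((\<lambda>r. pmom j (?l r) r) has_real_derivative
      pmom_rate j \<mu> r - pmom (Suc j) \<mu> r * (1/2 * \<mu> * (\<beta> + \<mu>))) (at r)"
    using pmom_path_has_derivative[where l = ?l and j = j, OF r(1) _ l] \<mu> by (simp add: \<mu>_def)
  have w: "cirw T s i r = prefactor i \<mu> * pmom i \<mu> r" for i
    by (simp add: cirw_eq \<mu>_def)
  have key: "real j * (a + real j - 1) * (prefactor j \<mu> * pmom (j - 1) \<mu> r)
      = real j * (\<beta> + \<mu>) * (prefactor (j - 1) \<mu> * pmom (j - 1) \<mu> r)"
  proof (cases j)
    case (Suc n)
    have "real j * (a + real j - 1) * (prefactor j \<mu> * pmom (j - 1) \<mu> r)
        = real j * (prefactor (Suc n) \<mu> * (a + real n)) * pmom (j - 1) \<mu> r"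
      by (simp add: Suc)
    also have "\<dots> = real j * (prefactor n \<mu> * (\<beta> + \<mu>)) * pmom (j - 1) \<mu> r"
      by (simp only: prefactor_Suc)
    finally show ?thesis by (simp add: Suc mult_ac)
  qed simp
  have cancel: "prefactor j \<mu> * (a + real j) / (\<beta> + \<mu>) * (1/2 * \<mu> * (\<beta> + \<mu>)) =
      1/2 * \<mu> * (a + real j) * prefactor j \<mu>"
    using b\<mu> by simp
  have "prefactor j \<mu> * (a + real j) / (\<beta> + \<mu>) * (1/2 * \<mu> * (\<beta> + \<mu>)) * pmom j \<mu> r
      + (pmom_rate j \<mu> r - pmom (Suc j) \<mu> r * (1/2 * \<mu> * (\<beta> + \<mu>))) * prefactor j \<mu>
    = 1/2 * (real j * (a + real j - 1) * (prefactor j \<mu> * pmom (j - 1) \<mu> r))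
      - 1/2 * real j * (\<beta> + \<mu>) * (prefactor j \<mu> * pmom j \<mu> r)"
    unfolding cancel pmom_rate_def by (simp add: field_simps)
  also have "\<dots> = (\<beta> + \<mu>) / 2 * real j * (cirw T s (j - 1) r - cirw T s j r)"
    unfolding key w by (simp add: algebra_simps)
  finally have val: "prefactor j \<mu> * (a + real j) / (\<beta> + \<mu>) * (1/2 * \<mu> * (\<beta> + \<mu>)) * pmom j \<mu> r
      + (pmom_rate j \<mu> r - pmom (Suc j) \<mu> r * (1/2 * \<mu> * (\<beta> + \<mu>))) * prefactor j \<mu>
    = (\<beta> + \<mu>) / 2 * real j * (cirw T s (j - 1) r - cirw T s j r)" .
  have "((\<lambda>r. prefactor j (?l r) * pmom j (?l r) r) has_real_derivative
      (\<beta> + \<mu>) / 2 * real j * (cirw T s (j - 1) r - cirw T s j r)) (at r)"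
    using DERIV_mult[OF 1 2] unfolding \<mu>_def[symmetric] val .
  moreover have eq: "cirw T s j = (\<lambda>r. prefactor j (?l r) * pmom j (?l r) r)"
    by (rule ext) (rule cirw_eq)
  ultimately show ?thesis unfolding eq[symmetric] \<mu>_def by simp
qed

text \<open>The bound is uniform in the starting value of the flow, which permits the limit to a zero
  starting value.\<close>

lemma cirw_bounded:
  assumes \<sigma>: "\<sigma> \<ge> 0" and T: "T \<ge> 0"
  shows "\<exists>C. \<forall>s r. 0 < s \<longrightarrow> s \<le> \<sigma> \<longrightarrow> 0 \<le> r \<longrightarrow> r \<le> T \<longrightarrow> cirw T s j r \<le> C"
proof -
  let ?G = "\<lambda>j. prefactor j \<sigma> * z ^ j"
  have init: "cirw T s j 0 \<le> ?G j" if s: "0 < s" "s \<le> \<sigma>" for s j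
  proof -
    have f: "0 \<le> sflow \<beta> s T" "sflow \<beta> s T \<le> \<sigma>"
      using sflow_nonneg[OF \<beta> _ T, of s] sflow_le[OF \<beta> _ T, of s] s by auto
    have "expmono j (sflow \<beta> s T) z \<le> z ^ j"
      using expmono_antimono[OF z f(1), of j] by (simp add: expmono_def)
    then show ?thesis
      unfolding cirw_0 hC_eq_expmono
      using prefactor_mono[OF f, of j] prefactor_nonneg[OF \<sigma>, of j] z
      by (intro mult_mono) (auto intro: expmono_nonneg)
  qed
  \<comment> \<open>The equation for \<open>j\<close> involves only \<open>j\<close> and
    \<open>j - 1\<close>, so the bounds are built up by induction; for \<open>j = 0\<close> the
    derivative vanishes.\<close>
  show ?thesis
  proof (induction j)
    case 0
    have "cirw T s 0 r = cirw T s 0 0" if "0 < s" "0 \<le> r" "r \<le> T" for s r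
    proof (cases "r = 0")
      case False
      show ?thesis
      proof (rule DERIV_isconst_end[of 0 r "cirw T s 0"])
        show "continuous_on {0..r} (cirw T s 0)"
          by (rule continuous_on_subset[OF cirw_continuous[OF \<open>0 < s\<close>, of T]]) (use that in auto)
        show "(cirw T s 0 has_real_derivative 0) (at x)" if "0 < x" "x < r" for x
          using cirw_has_derivative[OF \<open>0 < s\<close>, of x T 0] that \<open>r \<le> T\<close> by simp
      qed (use that False in auto)
    qed simp
    then have "cirw T s 0 r \<le> ?G 0" if "0 < s" "s \<le> \<sigma>" "0 \<le> r" "r \<le> T" for s r
      using init[OF that(1,2), of 0] that by metis
    then show ?case by (intro exI[of _ "?G 0"] allI impI)
  next
    case (Suc j)
    then obtain C where "\<forall>s r. 0 < s \<longrightarrow> s \<le> \<sigma> \<longrightarrow> 0 \<le> r \<longrightarrow> r \<le> T \<longrightarrow> cirw T s j r \<le> C" ..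
    note C = this[rule_format]
    \<comment> \<open>\<open>K\<close> bounds the gain term, since the flow stays below
      \<open>\<sigma>\<close>. The loss term has a favourable sign because \<open>cirw\<close> is
      nonnegative, so subtracting \<open>K * r\<close> leaves a nonincreasing function.\<close>
    define K where "K = (\<beta> + \<sigma>) / 2 * real (Suc j) * \<bar>C\<bar>"
    have K: "K \<ge> 0" using \<beta> \<sigma> by (simp add: K_def)
    have "cirw T s (Suc j) r \<le> ?G (Suc j) + K * T" if s: "0 < s" "s \<le> \<sigma>" and r: "0 \<le> r" "r \<le> T" for s r
    proof -
      have "cirw T s (Suc j) r - K * r \<le> cirw T s (Suc j) 0 - K * 0"
      proof (rule DERIV_nonpos_imp_decreasing_open[OF r(1), of "\<lambda>r. cirw T s (Suc j) r - K * r"])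
        fix x assume x: "0 < x" "x < r"
        let ?b = "(\<beta> + sflow \<beta> s (T - x)) / 2 * real (Suc j)"
        let ?d = "?b * (cirw T s j x - cirw T s (Suc j) x)"
        have fl: "0 \<le> sflow \<beta> s (T - x)" "sflow \<beta> s (T - x) \<le> \<sigma>"
          using sflow_nonneg[OF \<beta>, of s "T - x"] sflow_le[OF \<beta>, of s "T - x"] s r x by auto
        have b: "0 \<le> ?b" "?b \<le> (\<beta> + \<sigma>) / 2 * real (Suc j)"
          using fl \<beta> by (simp_all add: mult_right_mono)
        have "?d \<le> ?b * \<bar>C\<bar>"
          using C[OF s, of x] cirw_nonneg[of s x T "Suc j"] s r x b(1) by (intro mult_left_mono) auto
        also have "\<dots> \<le> K" unfolding K_def using b(2) by (intro mult_right_mono) auto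
        finally have "?d - K \<le> 0" by simp
        moreover have "((\<lambda>r. cirw T s (Suc j) r - K * r) has_real_derivative ?d - K) (at x)"
          using cirw_has_derivative[OF s(1), of x T "Suc j"] x r by (auto intro!: derivative_eq_intros)
        ultimately show "\<exists>y. ((\<lambda>r. cirw T s (Suc j) r - K * r) has_real_derivative y) (at x) \<and> y \<le> 0" by blast
      next
        show "continuous_on {0..r} (\<lambda>r. cirw T s (Suc j) r - K * r)"
          by (intro continuous_intros continuous_on_subset[OF cirw_continuous[OF s(1), of T]]) (use r in auto)
      qed
      moreover have "K * r \<le> K * T" using K r by (intro mult_left_mono)
      ultimately show ?thesis using init[OF s, of "Suc j"] by simp
    qed
    then show ?case by (intro exI[of _ "?G (Suc j) + K * T"] allI impI)
  qed
qed

end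

section \<open>The duality\<close>

text \<open>The Gamma factors of \<open>total \<alpha>\<close> in \<open>hC\<close> and
  \<open>hW\<close> are reciprocal and cancel; every other factor is multiplicative over the
  coordinates. The point \<open>z = 0\<close> is covered by
  \<open>h_zero_convention\<close>.\<close>

lemma h_eq_prod_hC:
  fixes \<alpha> z :: "real ^ 'n" and m :: "nat ^ 'n"
  assumes \<beta>: "\<beta> > 0" and \<alpha>: "\<And>i. \<alpha> $ i > 0" and z: "\<And>i. z $ i \<ge> 0" and s: "s \<ge> 0"
  shows "h \<beta> \<alpha> z m s = (\<Prod>i\<in>UNIV. hC \<beta> (\<alpha> $ i) (z $ i) (m $ i) s)"
proof -
  have \<theta>: "total \<alpha> > 0" using \<alpha> by (simp add: total_def sum_pos)
  then have G: "Gamma (total \<alpha>) > 0" "Gamma (total \<alpha> + real (total m)) > 0" by auto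
  have 1: "((\<beta> + s) / \<beta>) powr total \<alpha> = (\<Prod>i\<in>UNIV. ((\<beta> + s) / \<beta>) powr (\<alpha> $ i))"
    unfolding total_def using \<beta> s by (intro powr_sum) auto
  have 2: "(\<beta> + s) ^ total m = (\<Prod>i\<in>UNIV. (\<beta> + s) ^ (m $ i))"
    unfolding total_def by (rule power_sum)
  have 3: "exp (- s * total z) = (\<Prod>i\<in>UNIV. exp (- s * z $ i))"
    unfolding total_def sum_distrib_left by (rule exp_sum) simp
  let ?g = "\<Prod>i\<in>UNIV. Gamma (\<alpha> $ i) / Gamma (\<alpha> $ i + real (m $ i))"
  have "h \<beta> \<alpha> z m s = (Gamma (total \<alpha>) / Gamma (total \<alpha> + real (total m)) *
      (Gamma (total \<alpha> + real (total m)) / Gamma (total \<alpha>))) * (((\<beta> + s) / \<beta>) powr total \<alpha> * (\<beta> + s) ^ total m *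
      exp (- s * total z) * ?g * (total z ^ total m * mpow ((1 / total z) *\<^sub>R z) m))"
    unfolding h_def hC_def hW_def by (simp only: mult_ac)
  also have "\<dots> = ((\<beta> + s) / \<beta>) powr total \<alpha> * (\<beta> + s) ^ total m * exp (- s * total z) * ?g * mpow z m"
    unfolding h_zero_convention[OF z] using G by simp
  also have "\<dots> = (\<Prod>i\<in>UNIV. hC \<beta> (\<alpha> $ i) (z $ i) (m $ i) s)"
    unfolding 1 2 3 mpow_def hC_def prod.distrib[symmetric]
    by (intro prod.cong refl) (simp only: mult_ac)
  finally show ?thesis .
qed

section \<open>Interpolation between the two sides of the duality\<close>

locale duality = dual_transition \<beta> Q m s
  for \<beta> :: real and Q :: "real \<Rightarrow> (nat ^ 'n) \<times> real \<Rightarrow> ((nat ^ 'n) \<times> real) measure"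
    and m :: "nat ^ 'n" and s :: real +
  fixes \<alpha> z :: "real ^ 'n" and P :: "'n \<Rightarrow> real \<Rightarrow> real \<Rightarrow> real measure" and t :: real
  assumes cir: "\<And>i. cir_transition (\<alpha> $ i) \<beta> (P i) (z $ i)"
    and t: "t \<ge> 0"
begin

abbreviation w :: "real \<Rightarrow> 'n \<Rightarrow> nat \<Rightarrow> real \<Rightarrow> real" where
  "w e i \<equiv> cir_transition.cirw (\<alpha> $ i) \<beta> (P i) (z $ i) t (s + e)"

text \<open>\<open>H e k r\<close> is the expectation of the duality function at \<open>Z\<^sub>r\<close> when the flow, started at
  \<open>s + e\<close>, has been run for the remaining time \<open>t - r\<close>. The shift by \<open>e > 0\<close> keeps the
  test functions bounded when \<open>s = 0\<close>.\<close>

definition H :: "real \<Rightarrow> nat ^ 'n \<Rightarrow> real \<Rightarrow> real" where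
  "H e k r = (\<Prod>i\<in>UNIV. w e i (k $ i) r)"

lemma H_nonneg: "e > 0 \<Longrightarrow> 0 \<le> r \<Longrightarrow> r \<le> t \<Longrightarrow> H e k r \<ge> 0"
  unfolding H_def using s by (intro prod_nonneg ballI cir_transition.cirw_nonneg[OF cir]) auto

lemma H_continuous:
  assumes "e > 0"
  shows "continuous_on {0..t} (H e k)"
  unfolding H_def[abs_def] using assms s
  by (intro continuous_on_prod cir_transition.cirw_continuous[OF cir]) auto

text \<open>Shifts \<open>e \<le> 1\<close> keep all starting values below \<open>s + 1\<close>, so
  \<open>cirw_bounded\<close> applies with one constant. Uniformity in \<open>e\<close> is what
  makes the error of the interpolation vanish.\<close>

lemma H_bounded: "\<exists>C. \<forall>k\<in>below m. \<forall>e r. 0 < e \<longrightarrow> e \<le> 1 \<longrightarrow> 0 \<le> r \<longrightarrow> r \<le> t \<longrightarrow> H e k r \<le> C"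
proof -
  have "\<forall>i j. \<exists>C. \<forall>s' r. 0 < s' \<longrightarrow> s' \<le> s + 1 \<longrightarrow> 0 \<le> r \<longrightarrow> r \<le> t \<longrightarrow>
      cir_transition.cirw (\<alpha> $ i) \<beta> (P i) (z $ i) t s' j r \<le> C"
    using cir_transition.cirw_bounded[OF cir _ t, of "s + 1"] s by simp
  then obtain C where C: "\<forall>i j s' r. 0 < s' \<longrightarrow> s' \<le> s + 1 \<longrightarrow> 0 \<le> r \<longrightarrow> r \<le> t \<longrightarrow>
      cir_transition.cirw (\<alpha> $ i) \<beta> (P i) (z $ i) t s' j r \<le> C i j"
    by metis
  let ?B = "\<lambda>k. \<Prod>i\<in>UNIV. \<bar>C i (k $ i)\<bar>"
  have "H e k r \<le> (\<Sum>k\<in>below m. ?B k)"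
    if k: "k \<in> below m" and e: "0 < e" "e \<le> 1" and r: "0 \<le> r" "r \<le> t" for k e r
  proof -
    have "H e k r \<le> ?B k"
      unfolding H_def
    proof (intro prod_mono conjI)
      fix i
      show "0 \<le> w e i (k $ i) r"
        using s e r by (intro cir_transition.cirw_nonneg[OF cir]) auto
      have "w e i (k $ i) r \<le> C i (k $ i)"
        using C[rule_format, of "s + e" r] s e r by simp
      then show "w e i (k $ i) r \<le> \<bar>C i (k $ i)\<bar>" by simp
    qed
    also have "?B k \<le> (\<Sum>k\<in>below m. ?B k)"
      using k by (intro member_le_sum) (auto intro: prod_nonneg)
    finally show ?thesis .
  qed
  then show ?thesis by (intro exI[of _ "\<Sum>k\<in>below m. ?B k"] ballI allI impI)
qed

text \<open>All coordinates share \<open>\<beta>\<close> and the same flow, so each term of the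
  product rule carries the common factor \<open>(\<beta> + S) / 2\<close>. The one-dimensional death
  equations therefore add up to that of the multi-index.\<close>

lemma H_has_derivative:
  assumes e: "e > 0" and r: "0 < r" "r < t"
  shows "(H e k has_real_derivative (\<beta> + sflow \<beta> (s + e) (t - r)) / 2 *
    (\<Sum>i\<in>UNIV. real (k $ i) * (H e (k - axis i 1) r - H e k r))) (at r)"
proof -
  let ?c = "(\<beta> + sflow \<beta> (s + e) (t - r)) / 2"
  let ?d = "\<lambda>i. ?c * real (k $ i) * (w e i (k $ i - 1) r - w e i (k $ i) r)"
  have "(w e i (k $ i) has_real_derivative ?d i) (at r)" for i
    using s e r by (intro cir_transition.cirw_has_derivative[OF cir]) auto
  then have "((\<lambda>r. \<Prod>i\<in>UNIV. w e i (k $ i) r) has_real_derivative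
      (\<Sum>i\<in>UNIV. ?d i * (\<Prod>l\<in>UNIV - {i}. w e l (k $ l) r))) (at r)"
    by (rule has_field_derivative_prod)
  moreover have "?d i * (\<Prod>l\<in>UNIV - {i}. w e l (k $ l) r) =
      ?c * (real (k $ i) * (H e (k - axis i 1) r - H e k r))" for i
  proof -
    have 1: "H e k r = w e i (k $ i) r * (\<Prod>l\<in>UNIV - {i}. w e l (k $ l) r)"
      unfolding H_def by (subst prod.remove[of UNIV i]) auto
    have "H e (k - axis i 1) r =
        w e i ((k - axis i 1) $ i) r * (\<Prod>l\<in>UNIV - {i}. w e l ((k - axis i 1) $ l) r)"
      unfolding H_def by (subst prod.remove[of UNIV i]) auto
    also have "(\<Prod>l\<in>UNIV - {i}. w e l ((k - axis i 1) $ l) r) = (\<Prod>l\<in>UNIV - {i}. w e l (k $ l) r)"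
      by (intro prod.cong refl) (simp add: axis_def)
    also have "(k - axis i 1) $ i = k $ i - 1" by simp
    finally have 2: "H e (k - axis i 1) r = w e i (k $ i - 1) r * (\<Prod>l\<in>UNIV - {i}. w e l (k $ l) r)" .
    show ?thesis unfolding 1 2 by (simp only: left_diff_distrib right_diff_distrib mult_ac)
  qed
  moreover have "H e k = (\<lambda>r. \<Prod>i\<in>UNIV. w e i (k $ i) r)"
    by (rule ext) (rule H_def)
  ultimately show ?thesis by (simp only: sum_distrib_left)
qed

definition \<Phi> :: "real \<Rightarrow> real \<Rightarrow> real" where
  "\<Phi> e r = (\<Sum>k\<in>below m. law (t - r) k * H e k r)"

lemma \<Phi>_continuous:
  assumes "e > 0"
  shows "continuous_on {0..t} (\<Phi> e)"
  unfolding \<Phi>_def[abs_def]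
  by (intro continuous_intros H_continuous assms continuous_on_compose2[OF law_continuous]) auto

text \<open>The dual process carries the flow from \<open>s\<close>, the factor \<open>H\<close> the flow from \<open>s + e\<close>; up to this
  mismatch the forward equation of the one cancels the backward equation of the other.\<close>

lemma \<Phi>_has_derivative:
  assumes e: "e > 0" and r: "0 < r" "r < t"
  shows "(\<Phi> e has_real_derivative (sflow \<beta> (s + e) (t - r) - sflow \<beta> s (t - r)) / 2 *
    (\<Sum>k\<in>below m. law (t - r) k * (\<Sum>i\<in>UNIV. real (k $ i) * (H e (k - axis i 1) r - H e k r)))) (at r)"
proof -
  let ?S = "sflow \<beta> s (t - r)" and ?S' = "sflow \<beta> (s + e) (t - r)"
  let ?L = "\<lambda>k. law (t - r) k"
  let ?A = "\<lambda>k. \<Sum>i\<in>UNIV. real (k $ i + 1) * ?L (k + axis i 1) - real (k $ i) * ?L k"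
  let ?B = "\<lambda>k. \<Sum>i\<in>UNIV. real (k $ i) * (H e (k - axis i 1) r - H e k r)"
  have split: "(\<Sum>k\<in>below m. c * f k * - 1 * h k + c' * g k * l k) =
      c' * (\<Sum>k\<in>below m. l k * g k) - c * (\<Sum>k\<in>below m. f k * h k)"
    for c c' :: real and f g h l :: "nat ^ 'n \<Rightarrow> real"
    unfolding sum_distrib_left sum_subtractf[symmetric] by (intro sum.cong refl) (simp add: mult_ac)
  have "((\<lambda>t. law t k) has_real_derivative (\<beta> + ?S) / 2 * ?A k) (at (t - r))" for k
    using r by (intro law_has_derivative) simp
  moreover have "((\<lambda>r. t - r) has_real_derivative - 1) (at r)"
    by (auto intro!: derivative_eq_intros)
  ultimately have L: "((\<lambda>r. law (t - r) k) has_real_derivative (\<beta> + ?S) / 2 * ?A k * - 1) (at r)" for k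
    by (rule DERIV_chain2)
  have "(\<Phi> e has_real_derivative
      (\<Sum>k\<in>below m. (\<beta> + ?S) / 2 * ?A k * - 1 * H e k r + (\<beta> + ?S') / 2 * ?B k * ?L k)) (at r)"
    unfolding \<Phi>_def[abs_def] by (intro DERIV_sum DERIV_mult L H_has_derivative e r)
  moreover have "(\<Sum>k\<in>below m. (\<beta> + ?S) / 2 * ?A k * - 1 * H e k r + (\<beta> + ?S') / 2 * ?B k * ?L k)
      = (\<beta> + ?S') / 2 * (\<Sum>k\<in>below m. ?L k * ?B k) - (\<beta> + ?S) / 2 * (\<Sum>k\<in>below m. ?A k * H e k r)"
    by (rule split)
  \<comment> \<open>Summation by parts moves the death operator from \<open>law\<close> to
    \<open>H\<close>; the boundary term of \<open>sum_below_shift\<close> vanishes because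
    \<open>law\<close> is 0 outside \<open>below m\<close>.\<close>
  moreover have "(\<Sum>k\<in>below m. ?A k * H e k r) = (\<Sum>k\<in>below m. ?L k * ?B k)"
  proof -
    have shift: "(\<Sum>k\<in>below m. real (k $ i + 1) * ?L (k + axis i 1) * H e k r) =
        (\<Sum>k\<in>below m. real (k $ i) * ?L k * H e (k - axis i 1) r)" for i
    proof -
      have "(\<Sum>k | k \<in> below m \<and> k + axis i 1 \<notin> below m. real (k $ i + 1) * ?L (k + axis i 1) * H e k r) = 0"
        using r by (intro sum.neutral ballI) (simp add: law_outside_below)
      then show ?thesis
        using sum_below_shift[where a = ?L and F = "\<lambda>k. H e k r" and i = i and m = m] by simp
    qed
    have "(\<Sum>k\<in>below m. ?A k * H e k r) = (\<Sum>i\<in>UNIV.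
        (\<Sum>k\<in>below m. real (k $ i + 1) * ?L (k + axis i 1) * H e k r) - (\<Sum>k\<in>below m. real (k $ i) * ?L k * H e k r))"
      unfolding sum_distrib_right sum_subtractf[symmetric] left_diff_distrib
      by (rule sum.swap)
    also have "\<dots> = (\<Sum>i\<in>UNIV. \<Sum>k\<in>below m. ?L k * (real (k $ i) * (H e (k - axis i 1) r - H e k r)))"
      unfolding shift sum_subtractf[symmetric]
      by (intro sum.cong refl) (simp add: algebra_simps)
    also have "\<dots> = (\<Sum>k\<in>below m. ?L k * ?B k)"
      unfolding sum_distrib_left by (rule sum.swap)
    finally show ?thesis .
  qed
  moreover have "(\<beta> + x) / 2 * X - (\<beta> + y) / 2 * X = (x - y) / 2 * X" for x y X :: real
    by (simp add: field_simps)
  ultimately show ?thesis by (simp only:)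
qed

text \<open>In the derivative the gap of the two flows contributes at most \<open>e / 2\<close>. The
  values of \<open>H\<close> lie between 0 and \<open>C\<close> and \<open>law\<close> has total
  mass 1, so the remaining average is at most \<open>N\<close>; the mean value theorem
  concludes.\<close>

lemma \<Phi>_difference:
  "\<exists>K. \<forall>e. 0 < e \<longrightarrow> e \<le> 1 \<longrightarrow> \<bar>\<Phi> e t - \<Phi> e 0\<bar> \<le> K * e"
proof -
  from H_bounded obtain C where C: "\<forall>k\<in>below m. \<forall>e r. 0 < e \<longrightarrow> e \<le> 1 \<longrightarrow> 0 \<le> r \<longrightarrow> r \<le> t \<longrightarrow> H e k r \<le> C" ..
  define N where "N = (\<Sum>i\<in>UNIV. real (m $ i) * \<bar>C\<bar>)"
  have N: "N \<ge> 0" by (auto simp: N_def intro: sum_nonneg)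
  have "\<bar>\<Phi> e t - \<Phi> e 0\<bar> \<le> (N / 2 * t) * e" if e: "0 < e" "e \<le> 1" for e
  proof (cases "t = 0")
    case False
    then have "0 < t" using t by simp
    have "\<Phi> e differentiable (at x)" if "0 < x" "x < t" for x
      using \<Phi>_has_derivative[OF e(1) that] unfolding real_differentiable_def by (rule exI)
    from MVT[OF \<open>0 < t\<close> \<Phi>_continuous[OF e(1)] this]
    obtain l u where u: "0 < u" "u < t" "DERIV (\<Phi> e) u :> l" "\<Phi> e t - \<Phi> e 0 = (t - 0) * l" by metis
    let ?X = "\<Sum>k\<in>below m. law (t - u) k * (\<Sum>i\<in>UNIV. real (k $ i) * (H e (k - axis i 1) u - H e k u))"
    have l: "l = (sflow \<beta> (s + e) (t - u) - sflow \<beta> s (t - u)) / 2 * ?X"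
      using DERIV_unique[OF u(3) \<Phi>_has_derivative[OF e(1) u(1,2)]] .
    have B: "\<bar>\<Sum>i\<in>UNIV. real (k $ i) * (H e (k - axis i 1) u - H e k u)\<bar> \<le> N" if k: "k \<in> below m" for k
      unfolding N_def
    proof (intro order.trans[OF sum_abs] sum_mono)
      fix i
      have "0 \<le> H e k u" "0 \<le> H e (k - axis i 1) u"
        using e u by (auto intro: H_nonneg)
      moreover have "H e k u \<le> C" "H e (k - axis i 1) u \<le> C"
        using C[rule_format, OF k, of e u] C[rule_format, OF below_diff_axis[OF k], of e u i] e u by auto
      ultimately have "\<bar>H e (k - axis i 1) u - H e k u\<bar> \<le> \<bar>C\<bar>" by linarith
      moreover have "real (k $ i) \<le> real (m $ i)" using k by (simp add: below_def)
      ultimately show "\<bar>real (k $ i) * (H e (k - axis i 1) u - H e k u)\<bar> \<le> real (m $ i) * \<bar>C\<bar>"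
        unfolding abs_mult abs_of_nat by (intro mult_mono) auto
    qed
    have "\<bar>?X\<bar> \<le> (\<Sum>k\<in>below m. law (t - u) k * N)"
      using B law_nonneg by (intro order.trans[OF sum_abs] sum_mono) (auto simp: abs_mult intro!: mult_left_mono)
    also have "\<dots> = N"
      using law_sum_below[of "t - u"] u by (simp flip: sum_distrib_right)
    finally have X: "\<bar>?X\<bar> \<le> N" .
    have "\<bar>(sflow \<beta> (s + e) (t - u) - sflow \<beta> s (t - u)) / 2\<bar> \<le> e / 2"
      using sflow_diff[OF \<beta> s, of "t - u" e] u e by auto
    from mult_mono[OF this X] have "\<bar>l\<bar> \<le> e / 2 * N"
      unfolding l abs_mult using e by simp
    then have "t * \<bar>l\<bar> \<le> t * (e / 2 * N)" using t by (intro mult_left_mono)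
    then show ?thesis using u(4) t by (simp add: abs_mult mult_ac)
  qed simp
  then show ?thesis by blast
qed

lemma \<Phi>_end: "\<Phi> e t = H e m t"
proof -
  have "\<Phi> e t = (\<Sum>k\<in>below m. if m = k then H e k t else 0)"
    unfolding \<Phi>_def by (intro sum.cong) (auto simp: law_0 indicator_def)
  then show ?thesis by simp
qed

lemma \<Phi>_start: "\<Phi> e 0 = (\<Sum>k\<in>below m. law t k * (\<Prod>i\<in>UNIV. hC \<beta> (\<alpha> $ i) (z $ i) (k $ i) (sflow \<beta> (s + e) t)))"
  unfolding \<Phi>_def H_def cir_transition.cirw_0[OF cir] by simp

text \<open>At \<open>r = t\<close> the law is the point mass at \<open>m\<close>, which leaves
  \<open>H\<close>; at \<open>r = 0\<close> the shift enters only through \<open>hC\<close> at the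
  fixed point \<open>z\<close>, which is continuous in the flow. The two ends differ by a multiple
  of \<open>e\<close>.\<close>

lemma H_tendsto:
  "(\<lambda>n. H (inverse (real (Suc n))) m t) \<longlonglongrightarrow>
    (\<Sum>k\<in>below m. law t k * (\<Prod>i\<in>UNIV. hC \<beta> (\<alpha> $ i) (z $ i) (k $ i) (sflow \<beta> s t)))"
proof -
  let ?e = "\<lambda>n. inverse (real (Suc n))"
  have e: "0 < ?e n" "?e n \<le> 1" for n by (auto simp: divide_simps)
  from \<Phi>_difference obtain K where K: "\<forall>e. 0 < e \<longrightarrow> e \<le> 1 \<longrightarrow> \<bar>\<Phi> e t - \<Phi> e 0\<bar> \<le> K * e" ..
  have diff: "(\<lambda>n. \<Phi> (?e n) t - \<Phi> (?e n) 0) \<longlonglongrightarrow> 0"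
  proof (rule Lim_null_comparison)
    show "\<forall>\<^sub>F n in sequentially. norm (\<Phi> (?e n) t - \<Phi> (?e n) 0) \<le> K * ?e n"
      using K e by (intro always_eventually allI) simp
    show "(\<lambda>n. K * ?e n) \<longlonglongrightarrow> 0"
      using tendsto_mult[OF tendsto_const LIMSEQ_inverse_real_of_nat, of K] by simp
  qed
  have S: "(\<lambda>n. sflow \<beta> (s + ?e n) t) \<longlonglongrightarrow> sflow \<beta> s t"
  proof (rule tendsto_sandwich[where f = "\<lambda>_. sflow \<beta> s t" and h = "\<lambda>n. sflow \<beta> s t + ?e n"])
    show "(\<lambda>n. sflow \<beta> s t + ?e n) \<longlonglongrightarrow> sflow \<beta> s t"
      using tendsto_add[OF tendsto_const LIMSEQ_inverse_real_of_nat, of "sflow \<beta> s t"] by simp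
  qed (use sflow_diff[OF \<beta> s t less_imp_le[OF e(1)]] in \<open>auto intro!: always_eventually\<close>)
  have "\<beta> + sflow \<beta> s t > 0" using \<beta> sflow_nonneg[OF \<beta> s t] by simp
  then have hC: "(\<lambda>n. hC \<beta> a y j (sflow \<beta> (s + ?e n) t)) \<longlonglongrightarrow> hC \<beta> a y j (sflow \<beta> s t)" for a y j
    unfolding hC_def using \<beta> by (intro tendsto_intros S) auto
  have "(\<lambda>n. \<Phi> (?e n) 0) \<longlonglongrightarrow> (\<Sum>k\<in>below m. law t k * (\<Prod>i\<in>UNIV. hC \<beta> (\<alpha> $ i) (z $ i) (k $ i) (sflow \<beta> s t)))"
    unfolding \<Phi>_start by (intro tendsto_intros hC)
  from tendsto_add[OF diff this] show ?thesis by (simp add: \<Phi>_end)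
qed

end

lemma (in cir_transition) prefactor_pos: "\<mu> \<ge> 0 \<Longrightarrow> prefactor j \<mu> > 0"
  unfolding prefactor_def using a \<beta>
  by (intro mult_pos_pos divide_pos_pos Gamma_real_pos zero_less_power) (simp_all add: add_pos_nonneg)

text \<open>Independence is given for whole paths. Evaluation at \<open>t\<close> followed by
  \<open>f i\<close> is a measurable map of a path, so the composed random variables are independent
  and the expectation of their product factorises.\<close>

lemma independent_processes_expectation:
  fixes Z :: "'n::finite \<Rightarrow> real \<Rightarrow> 'w \<Rightarrow> real" and f :: "'n \<Rightarrow> real \<Rightarrow> real"
  assumes prob: "prob_space M" and indep: "independent_processes M half_line Z" and t: "t \<ge> 0"
    and distr: "\<And>i. distr M half_line (Z i t) = N i" and Z: "\<And>i. Z i t \<in> M \<rightarrow>\<^sub>M half_line"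
    and f: "\<And>i. f i \<in> borel_measurable borel" and int: "\<And>i. integrable (N i) (f i)"
  shows "integrable M (\<lambda>\<omega>. \<Prod>i\<in>UNIV. f i (Z i t \<omega>))"
    and "(\<integral>\<omega>. (\<Prod>i\<in>UNIV. f i (Z i t \<omega>)) \<partial>M) = (\<Prod>i\<in>UNIV. \<integral>y. f i y \<partial>N i)"
proof -
  interpret prob_space M by fact
  have f': "f i \<in> borel_measurable half_line" for i
    by (rule borel_measurable_half_line[OF f])
  have "indep_vars (\<lambda>_. borel) (\<lambda>i \<omega>. (\<lambda>p. f i (p t)) (\<lambda>t\<in>{0..}. Z i t \<omega>)) UNIV"
    using indep unfolding independent_processes_def
  proof (rule indep_vars_compose2)
    show "(\<lambda>p. f i (p t)) \<in> borel_measurable (\<Pi>\<^sub>M t\<in>{0..}. half_line)" for i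
    proof (rule measurable_compose[OF _ f'])
      show "(\<lambda>p. p t) \<in> (\<Pi>\<^sub>M t\<in>{0..}. half_line) \<rightarrow>\<^sub>M half_line"
        using measurable_component_singleton[of t "{0..}" "\<lambda>_. half_line"] t by simp
    qed
  qed
  then have ind: "indep_vars (\<lambda>_. borel) (\<lambda>i \<omega>. f i (Z i t \<omega>)) UNIV"
    using t by simp
  have int': "integrable M (\<lambda>\<omega>. f i (Z i t \<omega>))" for i
    using int[of i] unfolding distr[symmetric] by (subst (asm) integrable_distr_eq[OF Z f'])
  have "(\<integral>\<omega>. f i (Z i t \<omega>) \<partial>M) = (\<integral>y. f i y \<partial>N i)" for i
    unfolding distr[symmetric] by (rule integral_distr[OF Z f', symmetric])
  then show "(\<integral>\<omega>. (\<Prod>i\<in>UNIV. f i (Z i t \<omega>)) \<partial>M) = (\<Prod>i\<in>UNIV. \<integral>y. f i y \<partial>N i)"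
    using indep_vars_lebesgue_integral[OF finite ind int'] by simp
  show "integrable M (\<lambda>\<omega>. \<Prod>i\<in>UNIV. f i (Z i t \<omega>))"
    by (rule indep_vars_integrable[OF finite ind int'])
qed

theorem theorem4p1:
  fixes \<beta> :: real and \<alpha> :: "real ^ 'n"
    and \<Omega> :: "'w measure" and Z :: "'n \<Rightarrow> real \<Rightarrow> 'w \<Rightarrow> real"
    and \<Omega>' :: "'v measure" and M :: "real \<Rightarrow> 'v \<Rightarrow> nat ^ 'n" and S :: "real \<Rightarrow> 'v \<Rightarrow> real"
    and z :: "real ^ 'n" and m :: "nat ^ 'n" and s t :: real
  assumes "CARD('n) \<ge> 2"
    and "\<beta> > 0" and "\<And>i. \<alpha> $ i > 0"
    and "\<And>i. z $ i \<ge> 0" and "s \<ge> 0" and "t \<ge> 0"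
    and "\<And>i. cir_process \<Omega> (\<alpha> $ i) \<beta> (z $ i) (Z i)"
    and "independent_processes \<Omega> half_line Z"
    and "dual_process \<Omega>' \<beta> m s M S"
  shows "integrable \<Omega> (\<lambda>\<omega>. h \<beta> \<alpha> (\<chi> i. Z i t \<omega>) m s) \<and>
    integrable \<Omega>' (\<lambda>\<omega>. h \<beta> \<alpha> z (M t \<omega>) (S t \<omega>)) \<and>
    (\<integral>\<omega>. h \<beta> \<alpha> (\<chi> i. Z i t \<omega>) m s \<partial>\<Omega>) = (\<integral>\<omega>. h \<beta> \<alpha> z (M t \<omega>) (S t \<omega>) \<partial>\<Omega>')"
proof -
  note \<beta> = assms(2) and \<alpha> = assms(3) and z = assms(4) and s = assms(5) and t = assms(6)
  have "\<forall>i. \<exists>P. transition_function half_line P \<and>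
      has_generator half_line P (cir_domain (\<alpha> $ i) \<beta>) (cir_gen (\<alpha> $ i) \<beta>) \<and>
      markov_process \<Omega> half_line P (z $ i) (Z i)"
    using assms(7) unfolding cir_process_def markov_process_with_generator_def by blast
  then obtain P where P: "\<And>i. transition_function half_line (P i)"
      "\<And>i. has_generator half_line (P i) (cir_domain (\<alpha> $ i) \<beta>) (cir_gen (\<alpha> $ i) \<beta>)"
      "\<And>i. markov_process \<Omega> half_line (P i) (z $ i) (Z i)"
    by metis
  from assms(9) obtain Q where Q_props: "transition_function dual_space Q"
      "has_generator dual_space Q (dual_domain \<beta>) (dual_gen \<beta>)"
      "markov_process \<Omega>' dual_space Q (m, s) (\<lambda>t \<omega>. (M t \<omega>, S t \<omega>))"
    unfolding dual_process_def markov_process_with_generator_def by blast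
  interpret cir: cir_transition "\<alpha> $ i" \<beta> "P i" "z $ i" for i
    by unfold_locales (rule \<alpha> \<beta> z P)+
  interpret duality \<beta> Q m s \<alpha> z P t
    by unfold_locales (rule \<beta> s Q_props cir.cir_transition_axioms t)+
  have z_in: "z $ i \<in> space half_line" for i using z by (simp add: space_half_line)
  have prob: "prob_space \<Omega>" using P(3) by (simp add: markov_process_def)
  have Z: "Z i t \<in> \<Omega> \<rightarrow>\<^sub>M half_line" for i using P(3) t by (simp add: markov_process_def)
  have Z_nonneg: "Z i t \<omega> \<ge> 0" if "\<omega> \<in> space \<Omega>" for i \<omega>
    using measurable_space[OF Z that, of i] by (simp add: space_half_line)
  note Z_distr = markov_process_distr[OF P(1) P(3) t z_in]

  \<comment> \<open>The value of the dual side, to which both expectations are shown to be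
    equal.\<close>
  define R where "R = (\<Sum>k\<in>below m. law t k * h \<beta> \<alpha> z k (sflow \<beta> s t))"
  have R: "R = (\<Sum>k\<in>below m. law t k * (\<Prod>i\<in>UNIV. hC \<beta> (\<alpha> $ i) (z $ i) (k $ i) (sflow \<beta> s t)))"
    unfolding R_def by (subst h_eq_prod_hC[OF \<beta> \<alpha> z sflow_nonneg[OF \<beta> s t]]) (rule refl)

  let ?e = "\<lambda>n. inverse (real (Suc n))"
  \<comment> \<open>In the rate \<open>\<mu>\<close> the deterministic part \<open>c\<close>
    increases while the random part \<open>g\<close> decreases. Monotone convergence therefore needs
    \<open>g\<close> alone, and the known limit is first divided by the positive
    \<open>c\<close>.\<close>
  define c where "c \<mu> = (\<Prod>i\<in>UNIV. cir.prefactor i (m $ i) \<mu>)" for \<mu>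
  define g where "g \<mu> \<omega> = (\<Prod>i\<in>UNIV. expmono (m $ i) \<mu> (Z i t \<omega>))" for \<mu> \<omega>
  have e: "s + ?e n > 0" for n using s by (simp add: add_nonneg_pos)
  have c_pos: "c \<mu> > 0" if "\<mu> \<ge> 0" for \<mu>
    unfolding c_def using that by (intro prod_pos ballI cir.prefactor_pos)
  have h_eq: "h \<beta> \<alpha> (\<chi> i. Z i t \<omega>) m s = c s * g s \<omega>" if "\<omega> \<in> space \<Omega>" for \<omega>
    unfolding c_def g_def prod.distrib[symmetric] cir.hC_eq_expmono[symmetric]
    using h_eq_prod_hC[OF \<beta> \<alpha> _ s, of "\<chi> i. Z i t \<omega>" m] Z_nonneg[OF that] by simp

  have g_int: "integrable \<Omega> (g (s + ?e n))"
    and g_eq: "(\<integral>\<omega>. g (s + ?e n) \<omega> \<partial>\<Omega>) = (\<Prod>i\<in>UNIV. cir.pmom i (m $ i) (s + ?e n) t)" for n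
    unfolding g_def cir.pmom_def
    by (rule independent_processes_expectation[OF prob assms(8) t Z_distr Z expmono_measurable
          half_line_prob.expmono_integrable[OF cir.half_line_prob_P[OF t] e]])+
  have H_eq: "H (?e n) m t = c (s + ?e n) * (\<integral>\<omega>. g (s + ?e n) \<omega> \<partial>\<Omega>)" for n
    unfolding H_def cir.cirw_eq g_eq c_def using \<beta> by (simp add: prod.distrib)
  have e_lim: "(\<lambda>n. s + ?e n) \<longlonglongrightarrow> s"
    using tendsto_add[OF tendsto_const LIMSEQ_inverse_real_of_nat, of s] by simp
  have c_lim: "(\<lambda>n. c (s + ?e n)) \<longlonglongrightarrow> c s"
    unfolding c_def by (intro tendsto_prod isCont_tendsto_compose[OF DERIV_isCont[OF cir.prefactor_has_derivative[OF s]] e_lim])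
  have "(\<lambda>n. H (?e n) m t / c (s + ?e n)) \<longlonglongrightarrow> R / c s"
    using H_tendsto c_lim c_pos[OF s] unfolding R by (intro tendsto_divide) auto
  moreover have "H (?e n) m t / c (s + ?e n) = (\<integral>\<omega>. g (s + ?e n) \<omega> \<partial>\<Omega>)" for n
    unfolding H_eq using c_pos[OF less_imp_le[OF e[of n]]] by simp
  ultimately have g_lim: "(\<lambda>n. \<integral>\<omega>. g (s + ?e n) \<omega> \<partial>\<Omega>) \<longlonglongrightarrow> R / c s" by simp

  have g_mono: "AE \<omega> in \<Omega>. mono (\<lambda>n. g (s + ?e n) \<omega>)"
  proof (intro AE_I2 monoI)
    fix \<omega> and k l :: nat assume "\<omega> \<in> space \<Omega>" "k \<le> l"
    then show "g (s + ?e k) \<omega> \<le> g (s + ?e l) \<omega>"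
      unfolding g_def using Z_nonneg
      by (intro prod_mono conjI expmono_nonneg expmono_antimono) (auto intro!: le_imp_inverse_le)
  qed
  have g_nonneg: "AE \<omega> in \<Omega>. 0 \<le> g \<mu> \<omega>" for \<mu>
    unfolding g_def using Z_nonneg by (intro AE_I2 prod_nonneg ballI expmono_nonneg)
  have g_ptw: "AE \<omega> in \<Omega>. (\<lambda>n. g (s + ?e n) \<omega>) \<longlonglongrightarrow> g s \<omega>"
    unfolding g_def expmono_def by (intro AE_I2 tendsto_intros e_lim)
  have g_meas: "g s \<in> borel_measurable \<Omega>"
    unfolding g_def[abs_def]
    by (intro borel_measurable_prod measurable_compose[OF Z borel_measurable_half_line[OF expmono_measurable]])
  \<comment> \<open>As the shifts decrease to 0, \<open>g\<close> increases to \<open>g s\<close>,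
    and the finite limit of the integrals yields integrability of \<open>g s\<close> together with
    its value. This covers \<open>s = 0\<close>, where \<open>g s\<close> is an unbounded monomial
    unless \<open>m\<close> is 0.\<close>
  note g_s = integral_monotone_convergence_nonneg[OF g_int g_mono g_nonneg g_ptw g_lim g_meas]

  have left_int: "integrable \<Omega> (\<lambda>\<omega>. h \<beta> \<alpha> (\<chi> i. Z i t \<omega>) m s)"
    using g_s(1) by (subst Bochner_Integration.integrable_cong[OF refl h_eq]) auto
  have "(\<integral>\<omega>. h \<beta> \<alpha> (\<chi> i. Z i t \<omega>) m s \<partial>\<Omega>) = (\<integral>\<omega>. c s * g s \<omega> \<partial>\<Omega>)"
    by (rule Bochner_Integration.integral_cong[OF refl h_eq])
  also have "\<dots> = R" using g_s(2) c_pos[OF s] by simp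
  finally have left: "(\<integral>\<omega>. h \<beta> \<alpha> (\<chi> i. Z i t \<omega>) m s \<partial>\<Omega>) = R" .

  have h_meas: "h \<beta> \<alpha> z k \<in> borel_measurable borel" for k
    unfolding h_def[abs_def] hC_def by measurable
  have X: "(\<lambda>\<omega>. (M t \<omega>, S t \<omega>)) \<in> \<Omega>' \<rightarrow>\<^sub>M dual_space"
    using Q_props(3) t by (simp add: markov_process_def)
  have X_distr: "distr \<Omega>' dual_space (\<lambda>\<omega>. (M t \<omega>, S t \<omega>)) = Q t (m, s)"
    by (rule markov_process_distr[OF Q_props(1) Q_props(3) t start_in_space])
  note D = dual_expectation[where F = "h \<beta> \<alpha> z", OF t h_meas]
  have D_meas: "(\<lambda>x. h \<beta> \<alpha> z (fst x) (snd x)) \<in> borel_measurable dual_space"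
    using borel_measurable_integrable[OF D(1)] by (simp add: measurable_Q[OF t])
  have right_int: "integrable \<Omega>' (\<lambda>\<omega>. h \<beta> \<alpha> z (M t \<omega>) (S t \<omega>))"
    using D(1) integrable_distr_eq[OF X D_meas] unfolding X_distr by simp
  have "(\<integral>\<omega>. h \<beta> \<alpha> z (M t \<omega>) (S t \<omega>) \<partial>\<Omega>') = R"
    using D(2) integral_distr[OF X D_meas] unfolding X_distr R_def by simp
  with left left_int right_int show ?thesis by simp
qed

end
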